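(* Let $(a_0(n))_n$ and $(a_1(n))_n$ be real sequences with $2a_0(n)+a_1(n)=1$ for all $n$, and let $D_n^{M,1}$ be the associated modified Durrmeyer operators. Suppose $f\in C^2[0,1]$ and that the (finite) limit $L_1=\lim_{n\to\infty}a_1(n)$ exists. Then for every $x\in[0,1]$ and every integer $n\ge1$, \begin{align*} &\left|n\left[D_n^{M,1}(f;x)-f(x)\right]-x(1-x)f''(x)-\frac{1-2x}2(L_1+3)f'(x)\right|\\ &\le\frac1{n+2}\left(2\|f'\|_\infty+3\|f''\|_\infty\right)+\frac5{\sqrt{n+4}}\,\omega_1\!\left(f'';\frac1{\sqrt{n+4}}\right)+\frac98\,\omega_2\!\left(f'';\frac1{\sqrt{n+4}}\right)\\ &\quad+\frac12\left\{|L_1-a_1(n)|\,\|f'\|_\infty+|1+L_1|\left[\frac2{n+2}|f'(x)|+\sqrt{\frac2{n+2}}\;\omega_1\!\left(f';\sqrt{\frac2{n+2}}\right)+\frac98\,\omega_2\!\left(f';\sqrt{\frac2{n+2}}\right)\right]\right\}. \end{align*}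
   Context: Bernstein basis: $p_{n,k}(x)=\binom nk x^k(1-x)^{n-k}$ for $0\le k\le n$, $x\in[0,1]$ (with $0^0=1$), and $p_{n,k}=0$ if $k<0$ or $k>n$. Modified basis: given real sequences $a_0(n),a_1(n)$, put $a(x,n)=a_1(n)x+a_0(n)$ and, for $0\le k\le n$, $$p_{n,k}^{M,1}(x)=a(x,n)\,p_{n-1,k}(x)+a(1-x,n)\,p_{n-1,k-1}(x).$$ Modified Durrmeyer operator: $D_n^{M,1}(f;x)=(n+1)\sum_{k=0}^n p_{n,k}^{M,1}(x)\int_0^1p_{n,k}(t)f(t)\,dt$. (No positivity is assumed.) Moduli, for $g\in C[0,1]$ and $\delta>0$: $\omega_1(g;\delta)=\sup\{|g(s)-g(t)|: s,t\in[0,1],\ |s-t|\le\delta\}$ and $\omega_2(g;\delta)=\sup\{|g(t-h)-2g(t)+g(t+h)|: 0\le h\le\delta,\ t\pm h\in[0,1]\}$. $\|\cdot\|_\infty$ is the sup norm on $[0,1]$. *)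

theory Defs
  imports "HOL-Analysis.Analysis"
begin

text \<open>
  The library's \<^const>\<open>Bernstein\<close> has a natural-number index \<open>k\<close>; here \<open>k\<close> is an integer,
  so that \<open>p n (-1) = 0\<close> is available instead of a truncated \<open>0 - 1 = 0\<close>.
\<close>

definition bern :: "nat \<Rightarrow> int \<Rightarrow> real \<Rightarrow> real" where
  "bern n k x = (if 0 \<le> k \<and> k \<le> int n then Bernstein n (nat k) x else 0)"

definition coef :: "(nat \<Rightarrow> real) \<Rightarrow> (nat \<Rightarrow> real) \<Rightarrow> real \<Rightarrow> nat \<Rightarrow> real" where
  "coef a0 a1 x n = a1 n * x + a0 n"

text \<open>Meaningful only for \<open>n \<ge> 1\<close>, because of the index \<open>n - 1\<close>.\<close>

definition bern_M1 :: "(nat \<Rightarrow> real) \<Rightarrow> (nat \<Rightarrow> real) \<Rightarrow> nat \<Rightarrow> int \<Rightarrow> real \<Rightarrow> real" where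
  "bern_M1 a0 a1 n k x =
     coef a0 a1 x n * bern (n - 1) k x + coef a0 a1 (1 - x) n * bern (n - 1) (k - 1) x"

definition durrmeyer_M1 ::
    "(nat \<Rightarrow> real) \<Rightarrow> (nat \<Rightarrow> real) \<Rightarrow> nat \<Rightarrow> (real \<Rightarrow> real) \<Rightarrow> real \<Rightarrow> real" where
  "durrmeyer_M1 a0 a1 n f x =
     (real n + 1) * (\<Sum>k = 0..int n. bern_M1 a0 a1 n k x * integral {0..1} (\<lambda>t. bern n k t * f t))"

text \<open>
  The following suprema of reals are only used for \<open>g\<close> continuous on \<open>{0..1}\<close> and \<open>\<delta> > 0\<close>,
  so that the sets are nonempty and bounded.
\<close>

definition supnorm :: "(real \<Rightarrow> real) \<Rightarrow> real" where
  "supnorm g = (SUP t\<in>{0..1}. \<bar>g t\<bar>)"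

definition modulus1 :: "(real \<Rightarrow> real) \<Rightarrow> real \<Rightarrow> real" where
  "modulus1 g \<delta> = Sup {\<bar>g s - g t\<bar> | s t. s \<in> {0..1} \<and> t \<in> {0..1} \<and> \<bar>s - t\<bar> \<le> \<delta>}"

definition modulus2 :: "(real \<Rightarrow> real) \<Rightarrow> real \<Rightarrow> real" where
  "modulus2 g \<delta> = Sup {\<bar>g (t - h) - 2 * g t + g (t + h)\<bar> | t h.
     0 \<le> h \<and> h \<le> \<delta> \<and> t - h \<in> {0..1} \<and> t + h \<in> {0..1}}"

text \<open>
  \<open>f \<in> C\<^sup>2[0,1]\<close> with first and second derivatives \<open>f'\<close> and \<open>f''\<close>; derivatives are one-sided
  at the endpoints. On \<open>{0..1}\<close> the functions \<open>f'\<close> and \<open>f''\<close> are determined by \<open>f\<close>.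
\<close>

definition C2_on_unit ::
    "(real \<Rightarrow> real) \<Rightarrow> (real \<Rightarrow> real) \<Rightarrow> (real \<Rightarrow> real) \<Rightarrow> bool" where
  "C2_on_unit f f' f'' \<longleftrightarrow>
     (\<forall>t\<in>{0..1}. (f has_real_derivative f' t) (at t within {0..1})) \<and>
     (\<forall>t\<in>{0..1}. (f' has_real_derivative f'' t) (at t within {0..1})) \<and>
     continuous_on {0..1} f''"

end

theory Submission
  imports Defs
begin

text \<open>
  The modified operator is the classical Durrmeyer operator plus
  \<open>(1 + a\<^sub>1) (1 - 2 x) / (2 n)\<close> times its derivative, and the derivative is again a positive
  operator applied to \<open>f'\<close>. Both parts rest on Paltanea's estimate
  \<open>|L g - g(x)| \<le> |L(t - x)| / h \<sqdot> \<omega>\<^sub>1(g; h) + (1 + L((t - x)\<^sup>2) / (2 h\<^sup>2)) \<omega>\<^sub>2(g; h)\<close> for positive \<open>L\<close>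
  of mass \<open>1\<close> and \<open>h \<le> 1/2\<close>, in the pointwise form that some slope \<open>c\<close> with
  \<open>|c| \<le> \<omega>\<^sub>1(g; h) / h\<close> satisfies
  \<open>g(t) - g(x) \<le> c (t - x) + (1 + (t - x)\<^sup>2 / (2 h\<^sup>2)) \<omega>\<^sub>2(g; h)\<close> on \<open>[0,1]\<close>.
  For the derivative this is applied to \<open>f'\<close>. For the classical operator it is applied to \<open>f''\<close>
  and integrated twice, which bounds \<open>f\<close> minus its Taylor polynomial by a quartic in \<open>t - x\<close>,
  so that the first four central moments suffice. Lower bounds follow by passing to \<open>-f\<close>.
\<close>

subsection \<open>Moduli of continuity\<close>

lemma bdd_modulus1:
  fixes g :: "real \<Rightarrow> real"
  assumes "continuous_on {0..1} g"
  shows "bdd_above {\<bar>g s - g t\<bar> | s t. s \<in> {0..1} \<and> t \<in> {0..1} \<and> \<bar>s - t\<bar> \<le> \<delta>}"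
proof -
  have "bounded (g ` {0..1})"
    using assms compact_continuous_image compact_imp_bounded compact_Icc by blast
  then obtain M where "\<forall>y\<in>g ` {0..1}. norm y \<le> M"
    unfolding bounded_iff by blast
  then have M: "\<And>t. t \<in> {0..1} \<Longrightarrow> \<bar>g t\<bar> \<le> M" by simp
  have "\<bar>g s - g t\<bar> \<le> 2 * M" if "s \<in> {0..1}" "t \<in> {0..1}" for s t
    using M[OF that(1)] M[OF that(2)] by linarith
  then show ?thesis
    unfolding bdd_above_def by blast
qed

lemma bdd_modulus2:
  fixes g :: "real \<Rightarrow> real"
  assumes "continuous_on {0..1} g"
  shows "bdd_above {\<bar>g (t - h) - 2 * g t + g (t + h)\<bar> | t h.
     0 \<le> h \<and> h \<le> \<delta> \<and> t - h \<in> {0..1} \<and> t + h \<in> {0..1}}"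
proof -
  have "bounded (g ` {0..1})"
    using assms compact_continuous_image compact_imp_bounded compact_Icc by blast
  then obtain M where "\<forall>y\<in>g ` {0..1}. norm y \<le> M"
    unfolding bounded_iff by blast
  then have M: "\<And>t. t \<in> {0..1} \<Longrightarrow> \<bar>g t\<bar> \<le> M" by simp
  have "\<bar>g (t - h) - 2 * g t + g (t + h)\<bar> \<le> 4 * M"
    if "0 \<le> h" "t - h \<in> {0..1}" "t + h \<in> {0..1}" for t h
  proof -
    have "t \<in> {0..1}" using that by auto
    from M[OF this] M[OF that(2)] M[OF that(3)] show ?thesis by linarith
  qed
  then show ?thesis
    unfolding bdd_above_def by blast
qed

lemma modulus1_ge:
  assumes "continuous_on {0..1} g" "s \<in> {0..1}" "t \<in> {0..1}" "\<bar>s - t\<bar> \<le> \<delta>"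
  shows "\<bar>g s - g t\<bar> \<le> modulus1 g \<delta>"
  unfolding modulus1_def using assms by (intro cSup_upper bdd_modulus1) blast+

lemma modulus2_ge:
  assumes "continuous_on {0..1} g" "0 \<le> h" "h \<le> \<delta>" "t - h \<in> {0..1}" "t + h \<in> {0..1}"
  shows "\<bar>g (t - h) - 2 * g t + g (t + h)\<bar> \<le> modulus2 g \<delta>"
  unfolding modulus2_def using assms by (intro cSup_upper bdd_modulus2) blast+

lemma modulus1_nonneg:
  assumes "continuous_on {0..1} g" "0 \<le> \<delta>"
  shows "0 \<le> modulus1 g \<delta>"
  using modulus1_ge[OF assms(1), of 0 0 \<delta>] assms(2) by simp

lemma modulus2_nonneg:
  assumes "continuous_on {0..1} g" "0 \<le> \<delta>"
  shows "0 \<le> modulus2 g \<delta>"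
  using modulus2_ge[OF assms(1), of 0 \<delta> 0] assms(2) by simp

lemma modulus1_mono:
  assumes "continuous_on {0..1} g" "0 \<le> \<delta>" "\<delta> \<le> \<epsilon>"
  shows "modulus1 g \<delta> \<le> modulus1 g \<epsilon>"
  unfolding modulus1_def[of g \<delta>]
proof (rule cSup_least)
  have "\<bar>g 0 - g 0\<bar> \<in> {\<bar>g s - g t\<bar> | s t. s \<in> {0..1} \<and> t \<in> {0..1} \<and> \<bar>s - t\<bar> \<le> \<delta>}"
    using assms(2) by (intro CollectI exI[of _ 0]) auto
  then show "{\<bar>g s - g t\<bar> | s t. s \<in> {0..1} \<and> t \<in> {0..1} \<and> \<bar>s - t\<bar> \<le> \<delta>} \<noteq> {}" by blast
qed (use assms in \<open>auto intro!: modulus1_ge\<close>)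

lemma modulus2_mono:
  assumes "continuous_on {0..1} g" "0 \<le> \<delta>" "\<delta> \<le> \<epsilon>"
  shows "modulus2 g \<delta> \<le> modulus2 g \<epsilon>"
  unfolding modulus2_def[of g \<delta>]
proof (rule cSup_least)
  have "\<bar>g (0 - 0) - 2 * g 0 + g (0 + 0)\<bar> \<in> {\<bar>g (t - h) - 2 * g t + g (t + h)\<bar> | t h.
     0 \<le> h \<and> h \<le> \<delta> \<and> t - h \<in> {0..1} \<and> t + h \<in> {0..1}}"
    using assms(2) by (intro CollectI exI[of _ 0]) auto
  then show "{\<bar>g (t - h) - 2 * g t + g (t + h)\<bar> | t h.
     0 \<le> h \<and> h \<le> \<delta> \<and> t - h \<in> {0..1} \<and> t + h \<in> {0..1}} \<noteq> {}" by blast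
next
  fix y assume "y \<in> {\<bar>g (t - h) - 2 * g t + g (t + h)\<bar> | t h.
     0 \<le> h \<and> h \<le> \<delta> \<and> t - h \<in> {0..1} \<and> t + h \<in> {0..1}}"
  then obtain t h where "y = \<bar>g (t - h) - 2 * g t + g (t + h)\<bar>" "0 \<le> h" "h \<le> \<delta>"
    "t - h \<in> {0..1}" "t + h \<in> {0..1}" by blast
  then show "y \<le> modulus2 g \<epsilon>" using modulus2_ge[OF assms(1), of h \<epsilon> t] assms(3) by simp
qed

lemma modulus1_uminus: "modulus1 (\<lambda>t. - g t) \<delta> = modulus1 g \<delta>"
proof -
  have "\<bar>- g s - - g t\<bar> = \<bar>g s - g t\<bar>" for s t by linarith
  then show ?thesis unfolding modulus1_def by simp
qed

lemma modulus2_uminus: "modulus2 (\<lambda>t. - g t) \<delta> = modulus2 g \<delta>"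
proof -
  have "\<bar>- g (t - h) - 2 * - g t + - g (t + h)\<bar> = \<bar>g (t - h) - 2 * g t + g (t + h)\<bar>" for t h
    by linarith
  then show ?thesis unfolding modulus2_def by simp
qed

text \<open>The maximum principle: the parabola turns the bound on second differences of step \<open>h\<close>
  into convexity of step \<open>h\<close>, so that the leftmost maximum of \<open>u\<close> is \<open>h\<close>-close to an endpoint.
  On an interval of length at most \<open>2 h\<close> every point is, and the parabola is dropped (\<open>\<kappa> = 0\<close>).\<close>

lemma chord_deviation_le_modulus2:
  fixes g :: "real \<Rightarrow> real"
  assumes g: "continuous_on {0..1} g" and h: "0 < h"
    and ab: "0 \<le> a" "a \<le> x" "x \<le> b" "b \<le> 1"
    and \<kappa>: "0 \<le> \<kappa>" "b - a \<le> 2 * h \<or> \<kappa> = 1"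
    and zero: "g' = (\<lambda>t. g t - \<alpha> - \<beta> * t)" "g' a = 0" "g' b = 0"
  shows "- g' x \<le> (1 + \<kappa> * ((x - a) * (b - x) / (2 * h\<^sup>2))) * modulus2 g h"
proof -
  define W where "W = modulus2 g h"
  \<comment> \<open>Here \<open>g'\<close> is \<open>g\<close> minus an affine function, not a
    derivative. The subtracted parabola vanishes at \<open>a\<close> and \<open>b\<close>, and for
    \<open>\<kappa> = 1\<close> its second difference of step \<open>h\<close> is exactly
    \<open>- W\<close>, which cancels the bound on the second difference of
    \<open>g\<close>.\<close>
  define u where "u = (\<lambda>t. - g' t - \<kappa> * ((t - a) * (b - t) / (2 * h\<^sup>2)) * W)"
  have cont: "continuous_on {a..b} u"
    unfolding u_def zero(1) using h ab
    by (auto intro!: continuous_intros continuous_on_subset[OF g])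
  have step: "2 * u t \<le> W - \<kappa> * (d\<^sup>2 / h\<^sup>2) * W + u (t - d) + u (t + d)"
    if "0 \<le> d" "d \<le> h" "a \<le> t - d" "t + d \<le> b" for t d
  proof -
    have "\<bar>g (t - d) - 2 * g t + g (t + d)\<bar> \<le> W"
      unfolding W_def using that ab by (intro modulus2_ge g) auto
    moreover have "\<kappa> * ((t - a) * (b - t) / (2 * h\<^sup>2)) * 2 * W
      = \<kappa> * ((t - d - a) * (b - (t - d)) / (2 * h\<^sup>2)) * W
        + \<kappa> * ((t + d - a) * (b - (t + d)) / (2 * h\<^sup>2)) * W + \<kappa> * (d\<^sup>2 / h\<^sup>2) * W"
      using h by (simp add: field_simps power2_eq_square)
    ultimately show ?thesis unfolding u_def zero(1) by (simp add: algebra_simps abs_le_iff)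
  qed
  have compact: "compact {a..b}" "{a..b} \<noteq> {}" using ab by auto
  from continuous_attains_sup[OF compact cont]
  obtain t1 where t1: "t1 \<in> {a..b}" "\<And>t. t \<in> {a..b} \<Longrightarrow> u t \<le> u t1" by blast
  \<comment> \<open>The set of maxima is compact, so it has a leftmost point.\<close>
  define K where "K = {t \<in> {a..b}. u t = u t1}"
  have "closed K" unfolding K_def
    using continuous_closed_preimage_constant[OF cont] by simp
  moreover have "bounded K"
    by (rule bounded_subset[of "{a..b}"]) (auto simp: K_def)
  ultimately have "compact K" by (simp add: compact_eq_bounded_closed)
  moreover have "K \<noteq> {}" unfolding K_def using t1 by auto
  ultimately have "\<exists>t0\<in>K. \<forall>t\<in>K. t0 \<le> t" by (rule compact_attains_inf)
  then obtain t0 where t0: "t0 \<in> K" "\<And>t. t \<in> K \<Longrightarrow> t0 \<le> t" by auto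
  have t0': "a \<le> t0" "t0 \<le> b" "u t0 = u t1" using t0(1) by (auto simp: K_def)
  have ua: "u a = 0" "u b = 0" using zero by (auto simp: u_def)
  have W0: "0 \<le> W" unfolding W_def using g h by (intro modulus2_nonneg) auto
  have "u t0 \<le> W"
  proof -
    \<comment> \<open>When the nearer endpoint is within \<open>h\<close>, step exactly onto it:
      \<open>u\<close> vanishes there, and the other neighbour is at most \<open>u t0\<close>,
      leaving \<open>u t0 \<le> W\<close>.\<close>
    consider "t0 - a \<le> h" "t0 - a \<le> b - t0" | "b - t0 \<le> h" "b - t0 \<le> t0 - a"
      | "h < t0 - a" "h < b - t0" by linarith
    then show ?thesis
    proof cases
      case 1
      have "2 * u t0 \<le> W - \<kappa> * ((t0 - a)\<^sup>2 / h\<^sup>2) * W + u (t0 - (t0 - a)) + u (t0 + (t0 - a))"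
        using 1 t0' by (intro step) auto
      moreover have "u (t0 + (t0 - a)) \<le> u t0" using t1(2)[of "t0 + (t0 - a)"] t0' 1 by simp
      moreover have "0 \<le> \<kappa> * ((t0 - a)\<^sup>2 / h\<^sup>2) * W" using W0 \<kappa>(1) by simp
      ultimately show ?thesis using ua by simp
    next
      case 2
      have "2 * u t0 \<le> W - \<kappa> * ((b - t0)\<^sup>2 / h\<^sup>2) * W + u (t0 - (b - t0)) + u (t0 + (b - t0))"
        using 2 t0' by (intro step) auto
      moreover have "u (t0 - (b - t0)) \<le> u t0" using t1(2)[of "t0 - (b - t0)"] t0' 2 by simp
      moreover have "0 \<le> \<kappa> * ((b - t0)\<^sup>2 / h\<^sup>2) * W" using W0 \<kappa>(1) by simp
      ultimately show ?thesis using ua by simp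
    next
      case 3
      \<comment> \<open>The interval is longer than \<open>2 * h\<close>. With \<open>W\<close>
        cancelled, both neighbours at distance \<open>h\<close> must be maxima, and the left one
        contradicts the choice of \<open>t0\<close>.\<close>
      then have "\<kappa> = 1" using \<kappa>(2) by auto
      have "2 * u t0 \<le> W - \<kappa> * (h\<^sup>2 / h\<^sup>2) * W + u (t0 - h) + u (t0 + h)"
        using 3 h by (intro step) auto
      moreover have "u (t0 + h) \<le> u t1" "u (t0 - h) \<le> u t1" using 3 h by (auto intro!: t1(2))
      ultimately have "u (t0 - h) = u t1" using t0' h \<open>\<kappa> = 1\<close> by simp
      then have "t0 - h \<in> K" unfolding K_def using 3 h by auto
      from t0(2)[OF this] h show ?thesis by simp
    qed
  qed
  moreover have "u x \<le> u t0" using t1(2)[of x] t0' ab by auto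
  ultimately show ?thesis unfolding u_def W_def by (simp add: algebra_simps)
qed

text \<open>Subtracting the chord through the two endpoints gives a function vanishing at both, to
  which the maximum principle applies.\<close>

lemma chord_deviation:
  fixes g :: "real \<Rightarrow> real"
  assumes g: "continuous_on {0..1} g" and h: "0 < h"
    and ab: "0 \<le> a" "a \<le> x" "x \<le> b" "b \<le> 1" "a < b"
    and \<kappa>: "0 \<le> \<kappa>" "b - a \<le> 2 * h \<or> \<kappa> = 1"
  shows "((b - x) * g a + (x - a) * g b) / (b - a) - g x
    \<le> (1 + \<kappa> * ((x - a) * (b - x) / (2 * h\<^sup>2))) * modulus2 g h"
proof -
  define \<beta> where "\<beta> = (g b - g a) / (b - a)"
  have \<beta>: "g b = g a + \<beta> * (b - a)" using ab by (simp add: \<beta>_def)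
  have "- (g x - (g a - \<beta> * a) - \<beta> * x) \<le> (1 + \<kappa> * ((x - a) * (b - x) / (2 * h\<^sup>2))) * modulus2 g h"
    by (rule chord_deviation_le_modulus2[OF g h ab(1-4) \<kappa> refl]) (use \<beta> in \<open>auto simp: algebra_simps\<close>)
  moreover have "((b - x) * g a + (x - a) * g b) / (b - a) = g a + \<beta> * (x - a)"
    unfolding \<beta> using ab by (simp add: field_simps)
  ultimately show ?thesis by (simp add: algebra_simps)
qed

subsection \<open>The slope lemma\<close>

lemma abs_chord_deviation:
  fixes g :: "real \<Rightarrow> real"
  assumes g: "continuous_on {0..1} g" and h: "0 < h"
    and ab: "0 \<le> a" "a \<le> x" "x \<le> b" "b \<le> 1" "a < b" "b - a \<le> 2 * h"
  shows "\<bar>((b - x) * g a + (x - a) * g b) / (b - a) - g x\<bar> \<le> modulus2 g h"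
proof -
  have "((b - x) * g a + (x - a) * g b) / (b - a) - g x \<le> modulus2 g h"
    using chord_deviation[OF g h ab(1-5), of 0] ab by simp
  moreover have "((b - x) * - g a + (x - a) * - g b) / (b - a) - - g x \<le> modulus2 g h"
    using chord_deviation[OF continuous_on_minus[OF g] h ab(1-5), of 0] ab
    by (simp add: modulus2_uminus)
  moreover have "((b - x) * - g a + (x - a) * - g b) / (b - a) = - (((b - x) * g a + (x - a) * g b) / (b - a))"
    by (simp add: minus_divide_left)
  ultimately show ?thesis by linarith
qed

text \<open>A full step of length \<open>h\<close> is placed over \<open>[y, t]\<close>, to the
  right of \<open>y\<close> if there is room and otherwise to the left of \<open>t\<close>;
  \<open>h \<le> 1 / 2\<close> makes one of the two fit. The increment is the proportional part of
  the full step up to the chord error.\<close>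

lemma increment_le_short:
  fixes g :: "real \<Rightarrow> real"
  assumes g: "continuous_on {0..1} g" and h: "0 < h" "h \<le> 1 / 2"
    and yt: "0 \<le> y" "y \<le> t" "t \<le> 1" "t - y \<le> h"
  shows "\<bar>g t - g y\<bar> \<le> (t - y) / h * modulus1 g h + modulus2 g h"
proof -
  have triangle: "\<bar>b\<bar> \<le> Z + W"
    if "\<bar>d\<bar> \<le> W" "d = a - b \<or> d = b - a" "\<bar>a\<bar> \<le> Z" for a b d Z W :: real
    using that by linarith
  show ?thesis
  proof (cases "y + h \<le> 1")
    case True
    have "\<bar>((y + h - t) * g y + (t - y) * g (y + h)) / (y + h - y) - g t\<bar> \<le> modulus2 g h"
      using yt h True by (intro abs_chord_deviation g) auto
    moreover have "((y + h - t) * g y + (t - y) * g (y + h)) / (y + h - y) - g t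
        = (t - y) / h * (g (y + h) - g y) - (g t - g y)"
      using h by (simp add: field_simps)
    moreover have "\<bar>(t - y) / h * (g (y + h) - g y)\<bar> \<le> (t - y) / h * modulus1 g h"
      using yt h True modulus1_ge[OF g, of "y + h" y h]
      by (simp only: abs_mult) (intro mult_mono, auto)
    ultimately show ?thesis by (intro triangle) (assumption, blast+)
  next
    case False
    have "\<bar>((t - y) * g (t - h) + (y - (t - h)) * g t) / (t - (t - h)) - g y\<bar> \<le> modulus2 g h"
      using yt h False by (intro abs_chord_deviation g) auto
    moreover have "((t - y) * g (t - h) + (y - (t - h)) * g t) / (t - (t - h)) - g y
        = (g t - g y) - (t - y) / h * (g t - g (t - h))"
      using h by (simp add: field_simps)
    moreover have "\<bar>(t - y) / h * (g t - g (t - h))\<bar> \<le> (t - y) / h * modulus1 g h"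
      using yt h False modulus1_ge[OF g, of t "t - h" h]
      by (simp only: abs_mult) (intro mult_mono, auto)
    ultimately show ?thesis by (intro triangle) (assumption, blast+)
  qed
qed

text \<open>Full steps of length \<open>h\<close> are peeled off at the right end, each costing only
  \<open>modulus1 g h\<close>. The term \<open>modulus2 g h\<close> is paid once, for the remaining
  short piece.\<close>

lemma increment_steps:
  fixes g :: "real \<Rightarrow> real"
  assumes g: "continuous_on {0..1} g" and h: "0 < h" "h \<le> 1 / 2"
  shows "0 \<le> y \<Longrightarrow> y \<le> t \<Longrightarrow> t \<le> 1 \<Longrightarrow> t - y \<le> real (Suc m) * h \<Longrightarrow>
    \<bar>g t - g y\<bar> \<le> (t - y) / h * modulus1 g h + modulus2 g h"
proof (induction m arbitrary: t)
  case 0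
  then show ?case by (intro increment_le_short g h) auto
next
  case (Suc m)
  show ?case
  proof (cases "t - y \<le> h")
    case True
    then show ?thesis using Suc by (intro increment_le_short g h) auto
  next
    case False
    have "\<bar>g (t - h) - g y\<bar> \<le> (t - h - y) / h * modulus1 g h + modulus2 g h"
      using Suc.prems False h by (intro Suc.IH) (auto simp: algebra_simps)
    moreover have "\<bar>g t - g (t - h)\<bar> \<le> modulus1 g h"
      using Suc.prems False h by (intro modulus1_ge g) auto
    moreover have "(t - h - y) / h * modulus1 g h = (t - y) / h * modulus1 g h - modulus1 g h"
      using h by (simp add: field_simps)
    ultimately show ?thesis by linarith
  qed
qed

lemma increment_le:
  fixes g :: "real \<Rightarrow> real"
  assumes g: "continuous_on {0..1} g" and h: "0 < h" "h \<le> 1 / 2"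
    and yt: "y \<in> {0..1}" "t \<in> {0..1}"
  shows "\<bar>g t - g y\<bar> \<le> \<bar>t - y\<bar> / h * modulus1 g h + modulus2 g h"
proof -
  obtain m where "1 / h \<le> real m" using real_arch_simple by blast
  then have m: "1 \<le> real (Suc m) * h" using h by (simp add: field_simps)
  show ?thesis
  proof (cases "y \<le> t")
    case True
    then show ?thesis using increment_steps[OF g h, of y t m] yt m by auto
  next
    case False
    then show ?thesis using increment_steps[OF g h, of t y m] yt m by (auto simp: abs_minus_commute)
  qed
qed

text \<open>The slope \<open>c\<close> exists as soon as every lower bound imposed on it by a point to the right
  of \<open>x\<close> is at most every upper bound imposed by a point to the left; this is the chord estimate.\<close>

lemma exists_slope:
  fixes g :: "real \<Rightarrow> real"
  assumes g: "continuous_on {0..1} g" and h: "0 < h" "h \<le> 1 / 2" and x: "x \<in> {0..1}"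
  obtains c where "\<bar>c\<bar> \<le> modulus1 g h / h"
    and "\<And>t. t \<in> {0..1} \<Longrightarrow>
      g t - g x \<le> c * (t - x) + (1 + (t - x)\<^sup>2 / (2 * h\<^sup>2)) * modulus2 g h"
proof -
  define W where "W = modulus2 g h"
  define B where "B s = (1 + s\<^sup>2 / (2 * h\<^sup>2)) * W" for s
  define C where "C = modulus1 g h / h"
  have W0: "0 \<le> W" unfolding W_def using g h by (intro modulus2_nonneg) auto
  have C0: "0 \<le> C" unfolding C_def using g h modulus1_nonneg[OF g, of h] by simp
  have BW: "W \<le> B s" for s unfolding B_def using W0 h mult_right_mono[of 1 "1 + s\<^sup>2 / (2 * h\<^sup>2)" W] by simp
  \<comment> \<open>The parameter \<open>s\<close> is free because \<open>W\<close> is the least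
    value of \<open>B\<close>.\<close>
  have inc: "\<bar>g t - g x\<bar> \<le> C * \<bar>t - x\<bar> + B s" if "t \<in> {0..1}" for t s
    using increment_le[OF g h x that] BW[of s] unfolding C_def W_def by (simp add: field_simps)
  \<comment> \<open>The constraints from the points \<open>x + s\<close>, solved for the slope. The
    extra element \<open>- C\<close> secures the lower half of the bound on the absolute value of
    \<open>c\<close>, and keeps \<open>S\<close> nonempty when \<open>x = 1\<close>.\<close>
  define S where "S = insert (- C) {(g (x + s) - g x - B s) / s | s. 0 < s \<and> x + s \<le> 1}"
  have upper: "v \<le> C" if v: "v \<in> S" for v
  proof -
    consider "v = - C" | s where "v = (g (x + s) - g x - B s) / s" "0 < s" "x + s \<le> 1"
      using v by (auto simp: S_def)
    then show ?thesis
    proof cases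
      case 1
      then show ?thesis using C0 by simp
    next
      case 2
      then have "g (x + s) - g x - B s \<le> C * s" using inc[of "x + s" s] x by simp
      then show ?thesis using 2 by (simp add: divide_le_eq)
    qed
  qed
  have left: "v \<le> (g x - g (x - r) + B r) / r" if v: "v \<in> S" and r: "0 < r" "0 \<le> x - r" for v r
  proof -
    consider "v = - C" | s where "v = (g (x + s) - g x - B s) / s" "0 < s" "x + s \<le> 1"
      using v by (auto simp: S_def)
    then show ?thesis
    proof cases
      case 1
      then show ?thesis using inc[of "x - r" r] x r by (simp add: field_simps)
    next
      case 2
      \<comment> \<open>The chord over \<open>[x - r, x + s]\<close>, evaluated at \<open>x\<close>;
        its length is unrestricted, hence the version with the parabola.\<close>
      have "((x + s - x) * g (x - r) + (x - (x - r)) * g (x + s)) / (x + s - (x - r)) - g x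
        \<le> (1 + 1 * ((x - (x - r)) * (x + s - x) / (2 * h\<^sup>2))) * modulus2 g h"
        using 2 r by (intro chord_deviation g h) auto
      then have "(s * g (x - r) + r * g (x + s)) / (r + s) - g x \<le> (1 + r * s / (2 * h\<^sup>2)) * W"
        by (simp add: W_def add.commute)
      then have "((s * g (x - r) + r * g (x + s)) / (r + s) - g x) * (r + s)
          \<le> ((1 + r * s / (2 * h\<^sup>2)) * W) * (r + s)"
        using 2 r by (intro mult_right_mono) auto
      moreover have "((s * g (x - r) + r * g (x + s)) / (r + s) - g x) * (r + s)
          = s * g (x - r) + r * g (x + s) - g x * (r + s)"
        using 2 r by (simp add: left_diff_distrib)
      \<comment> \<open>The chord error splits exactly into the two allowances, since
        \<open>r * s\<^sup>2 + s * r\<^sup>2 = r * s * (r + s)\<close>. This is why the allowance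
        \<open>B\<close> is quadratic.\<close>
      moreover have "((1 + r * s / (2 * h\<^sup>2)) * W) * (r + s) = r * B s + s * B r"
        using h by (simp add: B_def field_simps power2_eq_square)
      ultimately have "r * (g (x + s) - g x - B s) \<le> s * (g x - g (x - r) + B r)"
        by (simp add: algebra_simps)
      then have "(g (x + s) - g x - B s) * r \<le> (g x - g (x - r) + B r) * s"
        by (simp only: mult.commute)
      then have "(g (x + s) - g x - B s) / s \<le> (g x - g (x - r) + B r) / r"
        using 2 r by (simp add: divide_le_eq le_divide_eq)
      then show ?thesis using 2 by simp
    qed
  qed
  define c where "c = Sup S"
  have bdd: "bdd_above S" using upper by (auto simp: bdd_above_def)
  have ne: "S \<noteq> {}" unfolding S_def by simp
  have c1: "v \<le> c" if "v \<in> S" for v unfolding c_def by (rule cSup_upper[OF that bdd])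
  show thesis
  proof (rule that)
    have "c \<le> C" unfolding c_def by (rule cSup_least[OF ne upper])
    moreover have "- C \<le> c" by (rule c1) (simp add: S_def)
    ultimately show "\<bar>c\<bar> \<le> modulus1 g h / h" unfolding C_def[symmetric] by simp
  next
    fix t :: real assume t: "t \<in> {0..1}"
    consider "t = x" | "x < t" | "t < x" by linarith
    then have "g t - g x \<le> c * (t - x) + B (t - x)"
    proof cases
      case 1
      then show ?thesis using BW[of 0] W0 by simp
    next
      case 2
      have "(g (x + (t - x)) - g x - B (t - x)) / (t - x) \<le> c"
        using 2 t by (intro c1) (auto simp: S_def intro!: exI[of _ "t - x"])
      then show ?thesis using 2 by (simp add: divide_le_eq algebra_simps)
    next
      case 3
      have "c \<le> (g x - g (x - (x - t)) + B (x - t)) / (x - t)"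
        unfolding c_def using 3 t by (intro cSup_least[OF ne] left) auto
      moreover have "B (x - t) = B (t - x)" unfolding B_def by (simp add: power2_commute)
      ultimately show ?thesis using 3 by (simp add: le_divide_eq algebra_simps)
    qed
    then show "g t - g x \<le> c * (t - x) + (1 + (t - x)\<^sup>2 / (2 * h\<^sup>2)) * modulus2 g h"
      unfolding B_def W_def .
  qed
qed

subsection \<open>Bernstein polynomials and Durrmeyer-type operators\<close>

lemma Bernstein_eq_0: "n < k \<Longrightarrow> Bernstein n k x = 0"
  by (simp add: Bernstein_def)

lemma continuous_on_Bernstein [continuous_intros]: "continuous_on S (Bernstein n k)"
  unfolding Bernstein_def by (intro continuous_intros)

lemma Bernstein_Suc_0: "Bernstein (Suc n) 0 x = (1 - x) * Bernstein n 0 x"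
  by (simp add: Bernstein_def)

lemma Bernstein_Suc_Suc:
  "Bernstein (Suc n) (Suc k) x = x * Bernstein n k x + (1 - x) * Bernstein n (Suc k) x"
proof (cases "k < n")
  case True
  then have "n - k = Suc (n - Suc k)" by simp
  then show ?thesis by (simp add: Bernstein_def algebra_simps)
next
  case False
  then show ?thesis by (simp add: Bernstein_def binomial_eq_0 algebra_simps)
qed

lemma real_Suc_times_binomial:
  "(real k + 1) * real (Suc n choose Suc k) = (real n + 1) * real (n choose k)"
proof -
  have "real (Suc k * (Suc n choose Suc k)) = real (Suc n * (n choose k))"
    by (simp only: Suc_times_binomial)
  then show ?thesis by (simp only: of_nat_mult of_nat_Suc add.commute)
qed

text \<open>Absorbs a factor \<open>t\<close> into the basis, which reduces integrals of powers to
  total masses.\<close>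

lemma Bernstein_times_arg:
  "(real n + 1) * (t * Bernstein n k t) = (real k + 1) * Bernstein (Suc n) (Suc k) t"
proof -
  have "(real k + 1) * real (Suc n choose Suc k) = (real n + 1) * real (n choose k)"
    by (rule real_Suc_times_binomial)
  then have "(real k + 1) * real (Suc n choose Suc k) * (t ^ Suc k * (1 - t) ^ (n - k))
      = (real n + 1) * real (n choose k) * (t ^ Suc k * (1 - t) ^ (n - k))" by (simp only:)
  from this[symmetric] show ?thesis by (simp add: Bernstein_def mult_ac del: binomial_Suc_Suc)
qed

text \<open>The successors keep both indices free of truncated predecessors; the two coefficients
  come from the two absorption identities for binomials.\<close>

lemma DERIV_Bernstein:
  "(Bernstein (Suc n) (Suc k) has_real_derivative
      (real n + 1) * (Bernstein n k t - Bernstein n (Suc k) t)) (at t)"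
proof -
  note 1 = real_Suc_times_binomial[of k n]
  have 2: "real (n - k) * real (Suc n choose Suc k) = (real n + 1) * real (n choose Suc k)"
  proof -
    have "real ((Suc n - Suc k) * (Suc n choose Suc k)) = real (Suc n * (n choose Suc k))"
      using binomial_absorb_comp[of "Suc n" "Suc k"] by (simp only: diff_Suc_1)
    then show ?thesis by (simp only: of_nat_mult of_nat_Suc diff_Suc_Suc add.commute)
  qed
  have a: "((\<lambda>t. t ^ Suc k) has_real_derivative (real k + 1) * t ^ k) (at t)"
    using DERIV_pow[of "Suc k" t] by (simp add: add.commute)
  have b: "((\<lambda>t. (1 - t) ^ (n - k)) has_real_derivative - (real (n - k) * (1 - t) ^ (n - Suc k))) (at t)"
    by (auto intro!: derivative_eq_intros)
  have "(Bernstein (Suc n) (Suc k) has_real_derivative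
     real (Suc n choose Suc k) * ((real k + 1) * t ^ k * (1 - t) ^ (n - k)
       - real (n - k) * t ^ Suc k * (1 - t) ^ (n - Suc k))) (at t)"
    using DERIV_cmult[OF DERIV_mult[OF a b], of "real (Suc n choose Suc k)"]
    unfolding Bernstein_def by (simp add: mult_ac del: binomial_Suc_Suc power_Suc)
  also have "real (Suc n choose Suc k) * ((real k + 1) * t ^ k * (1 - t) ^ (n - k)
       - real (n - k) * t ^ Suc k * (1 - t) ^ (n - Suc k))
    = ((real k + 1) * real (Suc n choose Suc k)) * (t ^ k * (1 - t) ^ (n - k))
       - (real (n - k) * real (Suc n choose Suc k)) * (t ^ Suc k * (1 - t) ^ (n - Suc k))"
    by (simp add: right_diff_distrib mult_ac)
  also have "\<dots> = (real n + 1) * (Bernstein n k t - Bernstein n (Suc k) t)"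
    unfolding 1 2 by (simp add: Bernstein_def right_diff_distrib mult_ac)
  finally show ?thesis .
qed

section \<open>Integrals against Bernstein polynomials\<close>

text \<open>The condition \<open>k < n\<close> puts \<open>Suc k\<close> strictly between
  \<open>0\<close> and \<open>Suc n\<close>, so the boundary terms vanish at both ends.\<close>

lemma integral_Bernstein_by_parts:
  fixes f f' :: "real \<Rightarrow> real"
  assumes f: "\<And>t. t \<in> {0..1} \<Longrightarrow> (f has_real_derivative f' t) (at t within {0..1})"
    and f': "continuous_on {0..1} f'" and k: "k < n"
  shows "(real n + 1) * (integral {0..1} (\<lambda>t. Bernstein n (Suc k) t * f t)
      - integral {0..1} (\<lambda>t. Bernstein n k t * f t))
    = integral {0..1} (\<lambda>t. Bernstein (Suc n) (Suc k) t * f' t)"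
proof -
  have cf: "continuous_on {0..1} f"
    using f by (intro DERIV_continuous_on) auto
  let ?F = "\<lambda>t. Bernstein (Suc n) (Suc k) t * f t"
  have "((\<lambda>t. (real n + 1) * (Bernstein n k t - Bernstein n (Suc k) t) * f t
       + Bernstein (Suc n) (Suc k) t * f' t) has_integral (?F 1 - ?F 0)) {0..1}"
  proof (rule fundamental_theorem_of_calculus)
    fix t :: real assume "t \<in> {0..1}"
    from DERIV_mult[OF has_field_derivative_at_within[OF DERIV_Bernstein[of n k t]] f[OF this]]
    show "(?F has_vector_derivative (real n + 1) * (Bernstein n k t - Bernstein n (Suc k) t) * f t
       + Bernstein (Suc n) (Suc k) t * f' t) (at t within {0..1})"
      by (simp add: has_real_derivative_iff_has_vector_derivative[symmetric] mult_ac add.commute)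
  qed simp
  moreover have "?F 1 - ?F 0 = 0" using k by (simp add: Bernstein_def)
  ultimately have "integral {0..1} (\<lambda>t. (real n + 1) * (Bernstein n k t * f t - Bernstein n (Suc k) t * f t)
       + Bernstein (Suc n) (Suc k) t * f' t) = 0"
    by (simp add: integral_unique algebra_simps)
  moreover have "integral {0..1} (\<lambda>t. (real n + 1) * (Bernstein n k t * f t - Bernstein n (Suc k) t * f t)
       + Bernstein (Suc n) (Suc k) t * f' t)
    = (real n + 1) * (integral {0..1} (\<lambda>t. Bernstein n k t * f t)
        - integral {0..1} (\<lambda>t. Bernstein n (Suc k) t * f t))
      + integral {0..1} (\<lambda>t. Bernstein (Suc n) (Suc k) t * f' t)"
  proof -
    have int: "(\<lambda>t. Bernstein m j t * f t) integrable_on {0..1}"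
      "(\<lambda>t. Bernstein m j t * f' t) integrable_on {0..1}" for m j
      by (intro integrable_continuous_interval continuous_intros cf f')+
    show ?thesis
      by (simp only: integral_add integral_mult_right integral_diff int
          integrable_diff integrable_on_mult_right)
  qed
  ultimately show ?thesis by (simp add: algebra_simps)
qed

text \<open>Integration by parts against the constant \<open>1\<close> shows that all
  \<open>n + 1\<close> masses agree, and they add up to \<open>1\<close> because the basis is a
  partition of unity. No Beta integral is evaluated.\<close>

lemma integral_Bernstein:
  assumes "k \<le> n"
  shows "(real n + 1) * integral {0..1} (Bernstein n k) = 1"
proof -
  have "integral {0..1} (Bernstein n (Suc j)) = integral {0..1} (Bernstein n j)" if "j < n" for j
    using integral_Bernstein_by_parts[of "\<lambda>_. 1" "\<lambda>_. 0" j n] that by simp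
  then have const: "integral {0..1} (Bernstein n j) = integral {0..1} (Bernstein n 0)" if "j \<le> n" for j
    using that by (induction j) auto
  have "1 = integral {0..1} (\<lambda>t. \<Sum>j\<le>n. Bernstein n j t)" by simp
  also have "\<dots> = (\<Sum>j\<le>n. integral {0..1} (Bernstein n j))"
    by (intro integral_sum integrable_continuous_interval continuous_intros) auto
  also have "\<dots> = (\<Sum>j\<le>n. integral {0..1} (Bernstein n 0))" by (intro sum.cong const) auto
  finally show ?thesis using const[OF assms] by (simp add: algebra_simps)
qed

text \<open>Each factor \<open>t\<close> is absorbed by raising both indices, hence the
  generalisation over \<open>n\<close> and \<open>k\<close>. The accumulated factors form the
  Pochhammer symbols.\<close>

lemma integral_Bernstein_power:
  assumes "k \<le> n"
  shows "(real n + 1) * integral {0..1} (\<lambda>t. Bernstein n k t * t ^ j)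
    = pochhammer (real k + 1) j / pochhammer (real n + 2) j"
  using assms
proof (induction j arbitrary: n k)
  case 0
  then show ?case using integral_Bernstein[of k n] by simp
next
  case (Suc j)
  have "Bernstein n k t * t ^ Suc j
      = (real k + 1) / (real n + 1) * (Bernstein (Suc n) (Suc k) t * t ^ j)" for t
  proof -
    have "(real n + 1) * (t * Bernstein n k t) * t ^ j
        = (real k + 1) * Bernstein (Suc n) (Suc k) t * t ^ j"
      by (simp only: Bernstein_times_arg)
    then show ?thesis by (simp add: field_simps)
  qed
  then have "(real n + 1) * integral {0..1} (\<lambda>t. Bernstein n k t * t ^ Suc j)
      = (real n + 1) * ((real k + 1) / (real n + 1)
          * integral {0..1} (\<lambda>t. Bernstein (Suc n) (Suc k) t * t ^ j))"
    by simp
  also have "integral {0..1} (\<lambda>t. Bernstein (Suc n) (Suc k) t * t ^ j)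
      = pochhammer (real k + 2) j / pochhammer (real n + 3) j / (real n + 2)"
  proof -
    have "(real n + 2) * integral {0..1} (\<lambda>t. Bernstein (Suc n) (Suc k) t * t ^ j)
        = pochhammer (real k + 2) j / pochhammer (real n + 3) j"
      using Suc.IH[of "Suc k" "Suc n"] Suc.prems by (simp add: add_ac)
    moreover have "real n + 2 \<noteq> 0" by linarith
    ultimately show ?thesis by (metis nonzero_mult_div_cancel_left)
  qed
  also have "(real n + 1) * ((real k + 1) / (real n + 1)
      * (pochhammer (real k + 2) j / pochhammer (real n + 3) j / (real n + 2)))
    = ((real k + 1) * pochhammer (real k + 2) j) / ((real n + 2) * pochhammer (real n + 3) j)"
  proof -
    have "a * (b / a * (c / d / e)) = b * c / (e * d)" if "a \<noteq> 0" for a b c d e :: real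
      using that by (simp add: mult.commute)
    moreover have "real n + 1 \<noteq> 0" by linarith
    ultimately show ?thesis by blast
  qed
  also have "\<dots> = pochhammer (real k + 1) (Suc j) / pochhammer (real n + 2) (Suc j)"
    by (simp add: pochhammer_rec add.assoc)
  finally show ?case .
qed

section \<open>Moments of the Bernstein basis\<close>

text \<open>The degree recursion, moved from the basis to the weights \<open>\<phi>\<close>. It
  drives the induction for the moments and later isolates the classical part of the modified
  operator.\<close>

lemma sum_Bernstein_Suc:
  "(\<Sum>k\<le>Suc n. Bernstein (Suc n) k x * \<phi> k)
    = (\<Sum>k\<le>n. Bernstein n k x * ((1 - x) * \<phi> k + x * \<phi> (Suc k)))"
proof -
  have "(\<Sum>k\<le>n. Bernstein n (Suc k) x * \<phi> (Suc k)) + Bernstein n 0 x * \<phi> 0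
      = (\<Sum>k\<le>Suc n. Bernstein n k x * \<phi> k)"
    by (subst sum.atMost_Suc_shift) simp
  also have "\<dots> = (\<Sum>k\<le>n. Bernstein n k x * \<phi> k)" by (simp add: Bernstein_eq_0)
  finally have *: "(\<Sum>k\<le>n. Bernstein n (Suc k) x * \<phi> (Suc k))
    = (\<Sum>k\<le>n. Bernstein n k x * \<phi> k) - Bernstein n 0 x * \<phi> 0" by simp
  have "(\<Sum>k\<le>Suc n. Bernstein (Suc n) k x * \<phi> k) = (1 - x) * Bernstein n 0 x * \<phi> 0
     + (\<Sum>k\<le>n. (x * Bernstein n k x + (1 - x) * Bernstein n (Suc k) x) * \<phi> (Suc k))"
    by (subst sum.atMost_Suc_shift) (simp add: Bernstein_Suc_0 Bernstein_Suc_Suc)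
  also have "(\<Sum>k\<le>n. (x * Bernstein n k x + (1 - x) * Bernstein n (Suc k) x) * \<phi> (Suc k))
    = (\<Sum>k\<le>n. Bernstein n k x * (x * \<phi> (Suc k)))
      + (1 - x) * (\<Sum>k\<le>n. Bernstein n (Suc k) x * \<phi> (Suc k))"
    by (simp add: sum_distrib_left sum.distrib sum_subtractf algebra_simps)
  finally show ?thesis unfolding *
    by (simp add: sum_distrib_left sum.distrib sum_subtractf algebra_simps)
qed

text \<open>In the induction on \<open>n\<close>, averaging \<open>\<phi> k\<close> and
  \<open>\<phi> (Suc k)\<close> reproduces the power and adds only lower powers, whose sums are
  already known.\<close>

lemma Bernstein_raw_moments:
  "(\<Sum>k\<le>n. Bernstein n k x * real k) = real n * x"
  "(\<Sum>k\<le>n. Bernstein n k x * (real k)\<^sup>2) = real n * x + real n * (real n - 1) * x\<^sup>2"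
  "(\<Sum>k\<le>n. Bernstein n k x * real k ^ 3) = real n * x + 3 * real n * (real n - 1) * x\<^sup>2
     + real n * (real n - 1) * (real n - 2) * x ^ 3"
  "(\<Sum>k\<le>n. Bernstein n k x * real k ^ 4) = real n * x + 7 * real n * (real n - 1) * x\<^sup>2
     + 6 * real n * (real n - 1) * (real n - 2) * x ^ 3
     + real n * (real n - 1) * (real n - 2) * (real n - 3) * x ^ 4"
proof -
  show 1: "(\<Sum>k\<le>n. Bernstein n k x * real k) = real n * x" for n
    using sum_k_Bernstein[of n x] by (simp add: mult.commute)
  have S: "(\<Sum>k\<le>n. Bernstein n k x * (c * \<phi> k)) = c * (\<Sum>k\<le>n. Bernstein n k x * \<phi> k)" for c \<phi> n
    by (simp add: sum_distrib_left mult_ac)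
  show 2: "(\<Sum>k\<le>n. Bernstein n k x * (real k)\<^sup>2) = real n * x + real n * (real n - 1) * x\<^sup>2" for n
  proof (induction n)
    case (Suc n)
    have "(1 - x) * (real k)\<^sup>2 + x * (real (Suc k))\<^sup>2 = (real k)\<^sup>2 + (2 * x) * real k + x" for k
      by (simp add: algebra_simps power2_eq_square)
    then show ?case unfolding sum_Bernstein_Suc
      by (simp only: distrib_left sum.distrib S Suc 1 sum_distrib_right[symmetric] sum_Bernstein)
        (simp add: algebra_simps power2_eq_square)
  qed simp
  show 3: "(\<Sum>k\<le>n. Bernstein n k x * real k ^ 3) = real n * x + 3 * real n * (real n - 1) * x\<^sup>2
     + real n * (real n - 1) * (real n - 2) * x ^ 3" for n
  proof (induction n)
    case (Suc n)
    have "(1 - x) * real k ^ 3 + x * real (Suc k) ^ 3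
        = real k ^ 3 + (3 * x) * (real k)\<^sup>2 + (3 * x) * real k + x" for k
      by (simp add: algebra_simps power2_eq_square power3_eq_cube)
    then show ?case unfolding sum_Bernstein_Suc
      by (simp only: distrib_left sum.distrib S Suc 1 2 sum_distrib_right[symmetric] sum_Bernstein)
        (simp add: algebra_simps power2_eq_square power3_eq_cube)
  qed simp
  show "(\<Sum>k\<le>n. Bernstein n k x * real k ^ 4) = real n * x + 7 * real n * (real n - 1) * x\<^sup>2
     + 6 * real n * (real n - 1) * (real n - 2) * x ^ 3
     + real n * (real n - 1) * (real n - 2) * (real n - 3) * x ^ 4"
  proof (induction n)
    case (Suc n)
    have "(1 - x) * real k ^ 4 + x * real (Suc k) ^ 4
        = real k ^ 4 + (4 * x) * real k ^ 3 + (6 * x) * (real k)\<^sup>2 + (4 * x) * real k + x" for k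
      by (simp add: algebra_simps power2_eq_square power3_eq_cube power4_eq_xxxx)
    then show ?case unfolding sum_Bernstein_Suc
      by (simp only: distrib_left sum.distrib S Suc 1 2 3 sum_distrib_right[symmetric] sum_Bernstein)
        (simp add: algebra_simps power2_eq_square power3_eq_cube power4_eq_xxxx)
  qed simp
qed

section \<open>Durrmeyer-type operators and their moments\<close>

text \<open>For \<open>s = 0\<close> this is the Durrmeyer operator. For \<open>s = 1\<close> it is the operator that acts on
  derivatives: the derivative of the Durrmeyer operator of order \<open>n\<close> at \<open>f\<close> is
  \<open>n / (n + 2)\<close> times the operator for \<open>s = 1\<close> of order \<open>n - 1\<close> at \<open>f'\<close>. The factor in front makes
  the total mass \<open>1\<close>.\<close>

definition durr_op :: "nat \<Rightarrow> nat \<Rightarrow> real \<Rightarrow> (real \<Rightarrow> real) \<Rightarrow> real" where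
  "durr_op s n x g = (real n + 2 * real s + 1)
     * (\<Sum>k\<le>n. Bernstein n k x * integral {0..1} (\<lambda>t. Bernstein (n + 2 * s) (k + s) t * g t))"

lemma durr_op_add:
  assumes "continuous_on {0..1} f" "continuous_on {0..1} g"
  shows "durr_op s n x (\<lambda>t. f t + g t) = durr_op s n x f + durr_op s n x g"
proof -
  have "integral {0..1} (\<lambda>t. Bernstein m j t * (f t + g t))
    = integral {0..1} (\<lambda>t. Bernstein m j t * f t) + integral {0..1} (\<lambda>t. Bernstein m j t * g t)" for m j
    unfolding distrib_left
    by (intro integral_add integrable_continuous_interval continuous_intros assms)
  then show ?thesis by (simp add: durr_op_def distrib_left sum.distrib)
qed

lemma durr_op_cmult: "durr_op s n x (\<lambda>t. c * g t) = c * durr_op s n x g"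
proof -
  have "integral {0..1} (\<lambda>t. Bernstein m j t * (c * g t))
    = c * integral {0..1} (\<lambda>t. Bernstein m j t * g t)" for m j
    by (simp add: mult.left_commute)
  then show ?thesis by (simp add: durr_op_def sum_distrib_left mult_ac)
qed

lemma durr_op_mono:
  assumes "continuous_on {0..1} f" "continuous_on {0..1} g" "x \<in> {0..1}"
    and le: "\<And>t. t \<in> {0..1} \<Longrightarrow> f t \<le> g t"
  shows "durr_op s n x f \<le> durr_op s n x g"
proof -
  have "integral {0..1} (\<lambda>t. Bernstein m j t * f t) \<le> integral {0..1} (\<lambda>t. Bernstein m j t * g t)" for m j
  proof (rule integral_le)
    fix t :: real assume "t \<in> {0..1}"
    then show "Bernstein m j t * f t \<le> Bernstein m j t * g t"
      by (intro mult_left_mono le Bernstein_nonneg) auto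
  qed (intro integrable_continuous_interval continuous_intros assms)+
  then show ?thesis
    unfolding durr_op_def using assms(3)
    by (intro mult_left_mono sum_mono Bernstein_nonneg) auto
qed

lemma durr_op_power:
  "durr_op s n x (\<lambda>t. t ^ j) = (\<Sum>k\<le>n. Bernstein n k x * pochhammer (real k + real s + 1) j)
     / pochhammer (real n + 2 * real s + 2) j"
proof -
  have "(real n + 2 * real s + 1) * integral {0..1} (\<lambda>t. Bernstein (n + 2 * s) (k + s) t * t ^ j)
    = pochhammer (real k + real s + 1) j / pochhammer (real n + 2 * real s + 2) j" if "k \<le> n" for k
    using integral_Bernstein_power[of "k + s" "n + 2 * s" j] that by simp
  then have "(real n + 2 * real s + 1) * (Bernstein n k x
        * integral {0..1} (\<lambda>t. Bernstein (n + 2 * s) (k + s) t * t ^ j))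
    = Bernstein n k x * pochhammer (real k + real s + 1) j / pochhammer (real n + 2 * real s + 2) j"
    if "k \<le> n" for k
    using that by (simp only: mult.left_commute[of _ "Bernstein n k x"] times_divide_eq_right)
  then show ?thesis
    unfolding durr_op_def sum_distrib_left sum_divide_distrib by (intro sum.cong refl) auto
qed

lemma durr_op_0: "durr_op s n x (\<lambda>t. 0) = 0"
  by (simp add: durr_op_def)

lemma durr_op_sum:
  assumes "\<And>i. i \<in> I \<Longrightarrow> continuous_on {0..1} (g i)"
  shows "durr_op s n x (\<lambda>t. \<Sum>i\<in>I. c i * g i t) = (\<Sum>i\<in>I. c i * durr_op s n x (g i))"
  using assms
proof (induction I rule: infinite_finite_induct)
  case (insert i I)
  have "durr_op s n x (\<lambda>t. c i * g i t + (\<Sum>j\<in>I. c j * g j t))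
      = durr_op s n x (\<lambda>t. c i * g i t) + durr_op s n x (\<lambda>t. \<Sum>j\<in>I. c j * g j t)"
    using insert.prems by (intro durr_op_add continuous_intros) auto
  then show ?case using insert by (simp add: durr_op_cmult)
qed (simp_all add: durr_op_0)

lemma durr_op_central:
  "durr_op s n x (\<lambda>t. (t - x) ^ j) = (\<Sum>i\<le>j. (real (j choose i) * (- x) ^ (j - i)) * durr_op s n x (\<lambda>t. t ^ i))"
proof -
  have "(t - x) ^ j = (\<Sum>i\<le>j. (real (j choose i) * (- x) ^ (j - i)) * t ^ i)" for t
    using binomial_ring[of t "- x" j] by (simp add: mult_ac)
  then show ?thesis by (simp add: durr_op_sum continuous_intros)
qed

lemma pochhammer_small:
  fixes a :: real
  shows "pochhammer a 2 = a * (a + 1)" "pochhammer a 3 = a * (a + 1) * (a + 2)"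
    "pochhammer a 4 = a * (a + 1) * (a + 2) * (a + 3)"
  by (simp_all add: pochhammer_Suc eval_nat_numeral mult_ac)

text \<open>One rewrite rule for all moments used below; the Pochhammer symbols are expanded there
  with their zero coefficients written out so that they match it.\<close>

lemma sum_Bernstein_quartic:
  "(\<Sum>k\<le>n. Bernstein n k x * (c0 + c1 * real k + c2 * (real k)\<^sup>2 + c3 * real k ^ 3 + c4 * real k ^ 4))
    = c0 + c1 * (real n * x) + c2 * (real n * x + real n * (real n - 1) * x\<^sup>2)
      + c3 * (real n * x + 3 * real n * (real n - 1) * x\<^sup>2
         + real n * (real n - 1) * (real n - 2) * x ^ 3)
      + c4 * (real n * x + 7 * real n * (real n - 1) * x\<^sup>2
         + 6 * real n * (real n - 1) * (real n - 2) * x ^ 3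
         + real n * (real n - 1) * (real n - 2) * (real n - 3) * x ^ 4)"
  by (simp only: distrib_left sum.distrib mult.left_commute[of "Bernstein _ _ _"]
      sum_distrib_left[symmetric] sum_distrib_right[symmetric] sum_Bernstein
      Bernstein_raw_moments mult_1_left)

text \<open>The operator for \<open>s = 1\<close> is tested against quadratics and the one for
  \<open>s = 0\<close> against quartics, which determines the list.\<close>

lemma durr_op_raw:
  shows "durr_op s n x (\<lambda>t. t ^ 0) = 1"
    and "durr_op 1 n x (\<lambda>t. t ^ 1) = (real n * x + 2) / (real n + 4)"
    and "durr_op 1 n x (\<lambda>t. t ^ 2) = (6 + 6 * (real n * x) + real n * (real n - 1) * x\<^sup>2)
           / ((real n + 4) * (real n + 5))"
    and "durr_op 0 n x (\<lambda>t. t ^ 1) = (real n * x + 1) / (real n + 2)"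
    and "durr_op 0 n x (\<lambda>t. t ^ 2) = (2 + 4 * (real n * x) + real n * (real n - 1) * x\<^sup>2)
           / ((real n + 2) * (real n + 3))"
    and "durr_op 0 n x (\<lambda>t. t ^ 3) = (6 + 18 * (real n * x) + 9 * (real n * (real n - 1) * x\<^sup>2)
           + real n * (real n - 1) * (real n - 2) * x ^ 3)
           / ((real n + 2) * (real n + 3) * (real n + 4))"
    and "durr_op 0 n x (\<lambda>t. t ^ 4) = (24 + 96 * (real n * x) + 72 * (real n * (real n - 1) * x\<^sup>2)
           + 16 * (real n * (real n - 1) * (real n - 2) * x ^ 3)
           + real n * (real n - 1) * (real n - 2) * (real n - 3) * x ^ 4)
           / ((real n + 2) * (real n + 3) * (real n + 4) * (real n + 5))"
proof -
  show "durr_op s n x (\<lambda>t. t ^ 0) = 1" unfolding durr_op_power by simp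
  have "pochhammer (real k + real 1 + 1) 1
      = 2 + 1 * real k + 0 * (real k)\<^sup>2 + 0 * real k ^ 3 + 0 * real k ^ 4" for k by simp
  then show "durr_op 1 n x (\<lambda>t. t ^ 1) = (real n * x + 2) / (real n + 4)"
    unfolding durr_op_power by (simp only: sum_Bernstein_quartic) (simp add: add.commute)
  have "pochhammer (real k + real 1 + 1) 2
      = 6 + 5 * real k + 1 * (real k)\<^sup>2 + 0 * real k ^ 3 + 0 * real k ^ 4" for k
    by (simp add: pochhammer_small power2_eq_square algebra_simps)
  then show "durr_op 1 n x (\<lambda>t. t ^ 2) = (6 + 6 * (real n * x) + real n * (real n - 1) * x\<^sup>2)
           / ((real n + 4) * (real n + 5))"
    unfolding durr_op_power by (simp only: sum_Bernstein_quartic) (simp add: pochhammer_small add_ac mult_ac)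
  have "pochhammer (real k + real 0 + 1) 1
      = 1 + 1 * real k + 0 * (real k)\<^sup>2 + 0 * real k ^ 3 + 0 * real k ^ 4" for k by simp
  then show "durr_op 0 n x (\<lambda>t. t ^ 1) = (real n * x + 1) / (real n + 2)"
    unfolding durr_op_power by (simp only: sum_Bernstein_quartic) (simp add: add.commute)
  have "pochhammer (real k + real 0 + 1) 2
      = 2 + 3 * real k + 1 * (real k)\<^sup>2 + 0 * real k ^ 3 + 0 * real k ^ 4" for k
    by (simp add: pochhammer_small power2_eq_square algebra_simps)
  then show "durr_op 0 n x (\<lambda>t. t ^ 2) = (2 + 4 * (real n * x) + real n * (real n - 1) * x\<^sup>2)
           / ((real n + 2) * (real n + 3))"
    unfolding durr_op_power by (simp only: sum_Bernstein_quartic) (simp add: pochhammer_small add_ac mult_ac)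
  have "pochhammer (real k + real 0 + 1) 3
      = 6 + 11 * real k + 6 * (real k)\<^sup>2 + 1 * real k ^ 3 + 0 * real k ^ 4" for k
    by (simp add: pochhammer_small power2_eq_square power3_eq_cube algebra_simps)
  then show "durr_op 0 n x (\<lambda>t. t ^ 3) = (6 + 18 * (real n * x) + 9 * (real n * (real n - 1) * x\<^sup>2)
           + real n * (real n - 1) * (real n - 2) * x ^ 3)
           / ((real n + 2) * (real n + 3) * (real n + 4))"
    unfolding durr_op_power by (simp only: sum_Bernstein_quartic) (simp add: pochhammer_small add_ac mult_ac)
  have "pochhammer (real k + real 0 + 1) 4
      = 24 + 50 * real k + 35 * (real k)\<^sup>2 + 10 * real k ^ 3 + 1 * real k ^ 4" for k
    by (simp add: pochhammer_small power2_eq_square power3_eq_cube power4_eq_xxxx algebra_simps)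
  then show "durr_op 0 n x (\<lambda>t. t ^ 4) = (24 + 96 * (real n * x) + 72 * (real n * (real n - 1) * x\<^sup>2)
           + 16 * (real n * (real n - 1) * (real n - 2) * x ^ 3)
           + real n * (real n - 1) * (real n - 2) * (real n - 3) * x ^ 4)
           / ((real n + 2) * (real n + 3) * (real n + 4) * (real n + 5))"
    unfolding durr_op_power by (simp only: sum_Bernstein_quartic) (simp add: pochhammer_small algebra_simps)
qed

lemma sum_upto_small:
  fixes \<phi> :: "nat \<Rightarrow> real"
  shows "(\<Sum>i\<le>1. \<phi> i) = \<phi> 0 + \<phi> 1" "(\<Sum>i\<le>2. \<phi> i) = \<phi> 0 + \<phi> 1 + \<phi> 2"
    "(\<Sum>i\<le>3. \<phi> i) = \<phi> 0 + \<phi> 1 + \<phi> 2 + \<phi> 3"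
    "(\<Sum>i\<le>4. \<phi> i) = \<phi> 0 + \<phi> 1 + \<phi> 2 + \<phi> 3 + \<phi> 4"
  by (simp_all add: eval_nat_numeral)

lemma binomial_small:
  "(2::nat) choose 1 = 2" "(3::nat) choose 1 = 3" "(3::nat) choose 2 = 3"
  "(4::nat) choose 1 = 4" "(4::nat) choose 2 = 6" "(4::nat) choose 3 = 4"
  by (simp_all add: eval_nat_numeral)

text \<open>Writing the moments in \<open>X\<close> and \<open>1 - 2 * x\<close> reflects the
  symmetry under \<open>x\<close> to \<open>1 - x\<close>: even moments are invariant, odd ones
  change sign. The leading powers of \<open>N\<close> have cancelled, which gives the decay.\<close>

lemma durr_op_central_moments:
  fixes x :: real and n :: nat
  defines "N \<equiv> real n" and "X \<equiv> x * (1 - x)"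
  shows "durr_op s n x (\<lambda>t. (t - x) ^ 0) = 1"
    and "durr_op 1 n x (\<lambda>t. (t - x) ^ 1) = (2 - 4 * x) / (N + 4)"
    and "durr_op 1 n x (\<lambda>t. (t - x) ^ 2) = (6 + (2 * N - 20) * X) / ((N + 4) * (N + 5))"
    and "durr_op 0 n x (\<lambda>t. (t - x) ^ 1) = (1 - 2 * x) / (N + 2)"
    and "durr_op 0 n x (\<lambda>t. (t - x) ^ 2) = (2 + 2 * (N - 3) * X) / ((N + 2) * (N + 3))"
    and "durr_op 0 n x (\<lambda>t. (t - x) ^ 3)
      = (1 - 2 * x) * (12 * (N - 1) * X + 6) / ((N + 2) * (N + 3) * (N + 4))"
    and "durr_op 0 n x (\<lambda>t. (t - x) ^ 4)
      = ((12 * N\<^sup>2 - 252 * N + 120) * X\<^sup>2 + (72 * N - 120) * X + 24)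
        / ((N + 2) * (N + 3) * (N + 4) * (N + 5))"
proof -
  have nz: "N + 2 \<noteq> 0" "N + 3 \<noteq> 0" "N + 4 \<noteq> 0" "N + 5 \<noteq> 0" unfolding N_def by linarith+
  show "durr_op s n x (\<lambda>t. (t - x) ^ 0) = 1" using durr_op_raw(1)[of s n x] by simp
  show "durr_op 1 n x (\<lambda>t. (t - x) ^ 1) = (2 - 4 * x) / (N + 4)"
    unfolding durr_op_central sum_upto_small durr_op_raw binomial_small N_def[symmetric] X_def
    using nz by (simp add: divide_simps) (simp add: algebra_simps)
  show "durr_op 1 n x (\<lambda>t. (t - x) ^ 2) = (6 + (2 * N - 20) * X) / ((N + 4) * (N + 5))"
    unfolding durr_op_central sum_upto_small durr_op_raw binomial_small N_def[symmetric] X_def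
    using nz by (simp add: divide_simps) (simp add: algebra_simps power2_eq_square)
  show "durr_op 0 n x (\<lambda>t. (t - x) ^ 1) = (1 - 2 * x) / (N + 2)"
    unfolding durr_op_central sum_upto_small durr_op_raw binomial_small N_def[symmetric] X_def
    using nz by (simp add: divide_simps) (simp add: algebra_simps)
  show "durr_op 0 n x (\<lambda>t. (t - x) ^ 2) = (2 + 2 * (N - 3) * X) / ((N + 2) * (N + 3))"
    unfolding durr_op_central sum_upto_small durr_op_raw binomial_small N_def[symmetric] X_def
    using nz by (simp add: divide_simps) (simp add: algebra_simps power2_eq_square)
  show "durr_op 0 n x (\<lambda>t. (t - x) ^ 3)
      = (1 - 2 * x) * (12 * (N - 1) * X + 6) / ((N + 2) * (N + 3) * (N + 4))"
    unfolding durr_op_central sum_upto_small durr_op_raw binomial_small N_def[symmetric] X_def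
    using nz by (simp add: divide_simps) (simp add: algebra_simps power2_eq_square power3_eq_cube)
  show "durr_op 0 n x (\<lambda>t. (t - x) ^ 4)
      = ((12 * N\<^sup>2 - 252 * N + 120) * X\<^sup>2 + (72 * N - 120) * X + 24)
        / ((N + 2) * (N + 3) * (N + 4) * (N + 5))"
    unfolding durr_op_central sum_upto_small durr_op_raw binomial_small N_def[symmetric] X_def
    using nz by (simp add: divide_simps) (simp add: algebra_simps power2_eq_square power3_eq_cube power4_eq_xxxx)
qed

subsection \<open>Estimates for the operators\<close>

lemma durr_op_le_polynomial:
  assumes "continuous_on {0..1} f" "x \<in> {0..1}"
    and "\<And>t. t \<in> {0..1} \<Longrightarrow> f t \<le> (\<Sum>i\<le>m. c i * (t - x) ^ i)"
  shows "durr_op s n x f \<le> (\<Sum>i\<le>m. c i * durr_op s n x (\<lambda>t. (t - x) ^ i))"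
proof -
  have "durr_op s n x f \<le> durr_op s n x (\<lambda>t. \<Sum>i\<le>m. c i * (t - x) ^ i)"
    using assms by (intro durr_op_mono continuous_intros)
  also have "\<dots> = (\<Sum>i\<le>m. c i * durr_op s n x (\<lambda>t. (t - x) ^ i))"
    by (intro durr_op_sum continuous_intros)
  finally show ?thesis .
qed

lemma durr_op_uminus: "durr_op s n x (\<lambda>t. - g t) = - durr_op s n x g"
  using durr_op_cmult[of s n x "-1" g] by simp

lemma abs_le_supnorm:
  assumes "continuous_on {0..1} g" "t \<in> {0..1}"
  shows "\<bar>g t\<bar> \<le> supnorm g"
proof -
  have "compact ((\<lambda>t. \<bar>g t\<bar>) ` {0..1})"
    by (intro compact_continuous_image continuous_intros assms compact_Icc)
  then have "bdd_above ((\<lambda>t. \<bar>g t\<bar>) ` {0..1})"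
    by (intro bounded_imp_bdd_above compact_imp_bounded)
  then show ?thesis unfolding supnorm_def using assms(2) by (intro cSUP_upper)
qed

lemma abs_durr_le_supnorm:
  assumes g: "continuous_on {0..1} g" and x: "x \<in> {0..1}"
  shows "\<bar>durr_op s n x g\<bar> \<le> supnorm g"
proof -
  have one: "durr_op s n x (\<lambda>t. supnorm g) = supnorm g"
    using durr_op_cmult[of s n x "supnorm g" "\<lambda>t. t ^ 0"] durr_op_raw(1)[of s n x] by simp
  have "g t \<le> supnorm g" "- g t \<le> supnorm g" if "t \<in> {0..1}" for t
    using abs_le_supnorm[OF g that] by linarith+
  then have "durr_op s n x g \<le> supnorm g" "durr_op s n x (\<lambda>t. - g t) \<le> supnorm g"
    using g x by (subst one[symmetric], intro durr_op_mono continuous_intros; simp)+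
  then show ?thesis unfolding durr_op_uminus by linarith
qed

section \<open>From a bound on the second derivative to a Taylor bound\<close>

lemma mvt_unit_interval:
  fixes g :: "real \<Rightarrow> real"
  assumes g: "\<And>t. t \<in> {0..1} \<Longrightarrow> (g has_real_derivative g' t) (at t within {0..1})"
    and ab: "a \<in> {0..1}" "b \<in> {0..1}"
  obtains \<xi> where "min a b \<le> \<xi>" "\<xi> \<le> max a b" "g b - g a = g' \<xi> * (b - a)"
proof -
  have *: "\<exists>\<xi>\<in>{u..v}. g v - g u = g' \<xi> * (v - u)" if "0 \<le> u" "u \<le> v" "v \<le> 1" for u v
  proof (rule mvt_very_simple[OF that(2)])
    fix t assume t: "u \<le> t" "t \<le> v"
    then have "(g has_real_derivative g' t) (at t within {u..v})"
      using that by (intro DERIV_subset[OF g]) auto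
    then show "(g has_derivative (*) (g' t)) (at t within {u..v})"
      by (simp add: has_field_derivative_def)
  qed
  show thesis
  proof (cases "a \<le> b")
    case True
    then show thesis using *[of a b] ab that by auto
  next
    case False
    then obtain \<xi> where "\<xi> \<in> {b..a}" "g a - g b = g' \<xi> * (a - b)" using *[of b a] ab by auto
    then show thesis using that[of \<xi>] False by (auto simp: algebra_simps)
  qed
qed

text \<open>Two applications of the mean value theorem turn \<open>g t\<close> into
  \<open>g'' \<eta> * (\<xi> - x) * (t - x)\<close>; the last two factors have the same sign because
  \<open>\<xi>\<close> lies between \<open>x\<close> and \<open>t\<close>.\<close>

lemma nonpos_of_second_derivative_nonpos:
  fixes g :: "real \<Rightarrow> real"
  assumes g: "\<And>t. t \<in> {0..1} \<Longrightarrow> (g has_real_derivative g' t) (at t within {0..1})"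
    and g': "\<And>t. t \<in> {0..1} \<Longrightarrow> (g' has_real_derivative g'' t) (at t within {0..1})"
    and le: "\<And>t. t \<in> {0..1} \<Longrightarrow> g'' t \<le> 0"
    and x: "x \<in> {0..1}" "g x = 0" "g' x = 0" and t: "t \<in> {0..1}"
  shows "g t \<le> 0"
proof -
  obtain \<xi> where \<xi>: "min x t \<le> \<xi>" "\<xi> \<le> max x t" "g t - g x = g' \<xi> * (t - x)"
    using mvt_unit_interval[OF g x(1) t] by blast
  have \<xi>01: "\<xi> \<in> {0..1}" using \<xi> x t by auto
  obtain \<eta> where \<eta>: "min x \<xi> \<le> \<eta>" "\<eta> \<le> max x \<xi>" "g' \<xi> - g' x = g'' \<eta> * (\<xi> - x)"
    using mvt_unit_interval[OF g' x(1) \<xi>01] by blast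
  have \<eta>01: "\<eta> \<in> {0..1}" using \<eta> x \<xi>01 by auto
  have "0 \<le> (\<xi> - x) * (t - x)" using \<xi>(1,2) by (auto simp: zero_le_mult_iff min_def max_def split: if_splits)
  then have "g'' \<eta> * ((\<xi> - x) * (t - x)) \<le> 0" by (intro mult_nonpos_nonneg le \<eta>01)
  then show ?thesis using \<xi>(3) \<eta>(3) x by (simp add: mult.assoc)
qed

lemma C2_on_unit_uminus:
  assumes "C2_on_unit f f' f''"
  shows "C2_on_unit (\<lambda>t. - f t) (\<lambda>t. - f' t) (\<lambda>t. - f'' t)"
  using assms unfolding C2_on_unit_def by (auto intro!: DERIV_minus continuous_intros)

lemma C2_on_unit_continuous:
  assumes "C2_on_unit f f' f''"
  shows "continuous_on {0..1} f" "continuous_on {0..1} f'" "continuous_on {0..1} f''"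
  using assms unfolding C2_on_unit_def by (auto intro!: DERIV_continuous_on)

text \<open>Integrates the slope estimate for \<open>f''\<close> twice: \<open>f\<close> minus the
  quartic has value and slope \<open>0\<close> at \<open>x\<close> and nonpositive second
  derivative.\<close>

lemma taylor_le_quartic:
  assumes C2: "C2_on_unit f f' f''" and h: "0 < h" and x: "x \<in> {0..1}" and t: "t \<in> {0..1}"
    and le: "\<And>t. t \<in> {0..1} \<Longrightarrow> f'' t - f'' x \<le> c * (t - x) + (1 + (t - x)\<^sup>2 / (2 * h\<^sup>2)) * W"
  shows "f t \<le> f x + f' x * (t - x) + f'' x / 2 * (t - x) ^ 2 + c / 6 * (t - x) ^ 3
    + W / 2 * (t - x) ^ 2 + W / (24 * h\<^sup>2) * (t - x) ^ 4"
proof -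
  define g where "g t = f t - (f x + f' x * (t - x) + (f'' x + W) / 2 * (t - x) ^ 2 + c / 6 * (t - x) ^ 3
    + W / (24 * h\<^sup>2) * (t - x) ^ 4)" for t
  define g' where "g' t = f' t - (f' x + (f'' x + W) * (t - x) + c / 2 * (t - x) ^ 2
    + W / (6 * h\<^sup>2) * (t - x) ^ 3)" for t
  define g'' where "g'' t = f'' t - (f'' x + W + c * (t - x) + W / (2 * h\<^sup>2) * (t - x) ^ 2)" for t
  have d: "(f has_real_derivative f' t) (at t within {0..1})"
    "(f' has_real_derivative f'' t) (at t within {0..1})" if "t \<in> {0..1}" for t
    using C2 that unfolding C2_on_unit_def by auto
  have "g t \<le> 0"
  proof (rule nonpos_of_second_derivative_nonpos[of g g' g'', OF _ _ _ x _ _ t])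
    fix t :: real assume t: "t \<in> {0..1}"
    show "(g has_real_derivative g' t) (at t within {0..1})"
      unfolding g_def[abs_def] g'_def using h
      by (auto intro!: derivative_eq_intros d t simp: divide_simps eval_nat_numeral algebra_simps)
    show "(g' has_real_derivative g'' t) (at t within {0..1})"
      unfolding g'_def[abs_def] g''_def using h
      by (auto intro!: derivative_eq_intros d t simp: divide_simps eval_nat_numeral algebra_simps)
    show "g'' t \<le> 0"
      using le[OF t] unfolding g''_def by (simp add: algebra_simps)
  qed (auto simp: g_def g'_def)
  then show ?thesis unfolding g_def by (simp add: add_divide_distrib algebra_simps)
qed

section \<open>Voronovskaya estimate for the classical operator\<close>

lemma logistic_bounds:
  fixes x :: real
  assumes "x \<in> {0..1}"
  shows "0 \<le> x * (1 - x)" "x * (1 - x) \<le> 1 / 4" "\<bar>1 - 2 * x\<bar> \<le> 1"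
proof -
  have "0 \<le> (x - 1 / 2)\<^sup>2" by simp
  then show "x * (1 - x) \<le> 1 / 4" by (simp add: power2_eq_square algebra_simps)
qed (use assms in auto)

text \<open>These are the coefficients that \<open>f' x\<close>, \<open>f'' x\<close>, the slope
  \<open>c\<close> and the second modulus receive in the quartic estimate; the factor
  \<open>N + 4\<close> is \<open>1 / h\<^sup>2\<close> for the step used there.\<close>

lemma durrmeyer_moment_bounds:
  fixes N x :: real
  assumes N: "1 \<le> N" and x: "x \<in> {0..1}"
  defines "X \<equiv> x * (1 - x)"
  defines "\<mu>1 \<equiv> (1 - 2 * x) / (N + 2)"
  defines "\<mu>2 \<equiv> (2 + 2 * (N - 3) * X) / ((N + 2) * (N + 3))"
  defines "\<mu>3 \<equiv> (1 - 2 * x) * (12 * (N - 1) * X + 6) / ((N + 2) * (N + 3) * (N + 4))"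
  defines "\<mu>4 \<equiv> ((12 * N\<^sup>2 - 252 * N + 120) * X\<^sup>2 + (72 * N - 120) * X + 24)
        / ((N + 2) * (N + 3) * (N + 4) * (N + 5))"
  shows "\<bar>N * \<mu>1 - (1 - 2 * x)\<bar> \<le> 2 / (N + 2)"
    and "\<bar>N * \<mu>2 / 2 - X\<bar> \<le> 1 / (N + 2)"
    and "\<bar>N * \<mu>3 / 6\<bar> * (N + 4) \<le> 5"
    and "N * \<mu>2 / 2 + N * \<mu>4 / 24 * (N + 4) \<le> 9 / 8"
proof -
  note X = logistic_bounds[OF x, folded X_def]
  have "N * \<mu>1 - (1 - 2 * x) = - 2 * (1 - 2 * x) / (N + 2)"
    using N unfolding \<mu>1_def by (simp add: field_simps)
  then show "\<bar>N * \<mu>1 - (1 - 2 * x)\<bar> \<le> 2 / (N + 2)"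
    using N X(3) by (simp add: abs_mult divide_right_mono)
  \<comment> \<open>Treating \<open>N * X\<close> as an unknown of its own makes the numerators
    below linear.\<close>
  have NX: "0 \<le> N * X" "N * X \<le> N / 4" using X N by (auto simp: field_simps)
  have "N * \<mu>2 / 2 - X = (N - (8 * (N * X) + 6 * X)) / (N + 3) * (1 / (N + 2))"
    using N unfolding \<mu>2_def by (simp add: divide_simps) (simp add: algebra_simps)
  moreover have "\<bar>(N - (8 * (N * X) + 6 * X)) / (N + 3)\<bar> \<le> 1"
  proof -
    have "\<bar>N - (8 * (N * X) + 6 * X)\<bar> \<le> N + 3" using N NX X by linarith
    then show ?thesis using N by (simp add: abs_divide)
  qed
  then have "\<bar>(N - (8 * (N * X) + 6 * X)) / (N + 3) * (1 / (N + 2))\<bar> \<le> 1 * \<bar>1 / (N + 2)\<bar>"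
    unfolding abs_mult by (rule mult_right_mono) simp
  ultimately show "\<bar>N * \<mu>2 / 2 - X\<bar> \<le> 1 / (N + 2)"
    using N by (simp only: mult_1_left) simp
  have "\<bar>N * \<mu>3 / 6\<bar> * (N + 4) = \<bar>N * \<mu>3 / 6 * (N + 4)\<bar>" using N by (simp add: abs_mult)
  also have "N * \<mu>3 / 6 * (N + 4) = (1 - 2 * x) * (N / (N + 2) * ((2 * (N * X) - 2 * X + 1) / (N + 3)))"
    using N unfolding \<mu>3_def by (simp add: divide_simps) (simp add: algebra_simps)
  also have "\<bar>\<dots>\<bar> \<le> 1 * (1 * 1)"
  proof -
    have "\<bar>2 * (N * X) - 2 * X + 1\<bar> \<le> N + 3" using N NX X by linarith
    then have "\<bar>(2 * (N * X) - 2 * X + 1) / (N + 3)\<bar> \<le> 1" using N by (simp add: abs_divide)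
    moreover have "\<bar>N / (N + 2)\<bar> \<le> 1" using N by simp
    ultimately show ?thesis unfolding abs_mult using X(3) by (intro mult_mono) auto
  qed
  finally show "\<bar>N * \<mu>3 / 6\<bar> * (N + 4) \<le> 5" by simp
  have "N * \<mu>2 / 2 = N * (1 + N * X - 3 * X) / ((N + 2) * (N + 3))"
    using N unfolding \<mu>2_def by (simp add: divide_simps) (simp add: algebra_simps)
  also have "\<dots> \<le> N * ((N + 4) / 4) / ((N + 2) * (N + 3))"
  proof -
    have "1 + y - 3 * X \<le> (N + 4) / 4" if "y \<le> N / 4" for y
      using X(1) that by (simp add: field_simps)
    from this[OF NX(2)] show ?thesis using N by (intro divide_right_mono mult_left_mono) auto
  qed
  also have "\<dots> \<le> 1 / 4"
    using N by (simp add: divide_simps) (simp add: algebra_simps)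
  finally have 1: "N * \<mu>2 / 2 \<le> 1 / 4" .
  have XX: "X\<^sup>2 \<le> 1 / 16" using power_mono[OF X(2,1), of 2] by (simp add: power2_eq_square)
  \<comment> \<open>The negative term \<open>- 252 * N\<close> is discarded first, so that the
    coefficient of \<open>X\<^sup>2\<close> is nonnegative and \<open>X\<^sup>2 \<le> 1 / 16\<close>
    can be inserted.\<close>
  have "(12 * N\<^sup>2 - 252 * N + 120) * X\<^sup>2 \<le> (12 * N\<^sup>2 + 120) * X\<^sup>2"
    using N by (intro mult_right_mono) auto
  also have "\<dots> \<le> (12 * N\<^sup>2 + 120) * (1 / 16)" using XX by (intro mult_left_mono) auto
  finally have "(12 * N\<^sup>2 - 252 * N + 120) * X\<^sup>2 \<le> 3 / 4 * N\<^sup>2 + 15 / 2" by simp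
  moreover have "(72 * N - 120) * X = 72 * (N * X) - 120 * X" by (simp add: algebra_simps)
  ultimately have "(12 * N\<^sup>2 - 252 * N + 120) * X\<^sup>2 + (72 * N - 120) * X + 24
      \<le> 3 / 4 * N\<^sup>2 + 18 * N + 32" (is "?num \<le> _")
    using NX X by linarith
  also have "\<dots> \<le> 3 * (N + 3) * (N + 5)" using N by (simp add: algebra_simps power2_eq_square)
  finally have num: "?num \<le> 3 * (N + 3) * (N + 5)" .
  have "N * \<mu>4 / 24 * (N + 4) = N * ?num / (24 * (N + 2) * (N + 3) * (N + 5))"
    using N unfolding \<mu>4_def by (simp add: divide_simps) (simp add: algebra_simps)
  also have "\<dots> \<le> N * (3 * (N + 3) * (N + 5)) / (24 * (N + 2) * (N + 3) * (N + 5))"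
    using N num by (intro divide_right_mono mult_left_mono) auto
  also have "\<dots> \<le> 1 / 8" using N by (simp add: divide_simps) (simp add: algebra_simps)
  finally show "N * \<mu>2 / 2 + N * \<mu>4 / 24 * (N + 4) \<le> 9 / 8" using 1 by simp
qed

lemma durrmeyer_voronovskaya_upper:
  fixes n :: nat
  assumes C2: "C2_on_unit f f' f''" and x: "x \<in> {0..1}" and n: "1 \<le> n"
  defines "h \<equiv> 1 / sqrt (real n + 4)"
  shows "real n * (durr_op 0 n x f - f x) - x * (1 - x) * f'' x - (1 - 2 * x) * f' x
    \<le> 1 / (real n + 2) * (2 * supnorm f' + 3 * supnorm f'')
      + 5 / sqrt (real n + 4) * modulus1 f'' h + 9 / 8 * modulus2 f'' h"
proof -
  define N X W where "N = real n" and "X = x * (1 - x)" and "W = modulus2 f'' h"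
  note cont = C2_on_unit_continuous[OF C2]
  have N: "1 \<le> N" using n by (simp add: N_def)
  have h: "0 < h" by (simp add: h_def add_nonneg_pos)
  \<comment> \<open>The shift by \<open>4\<close> in the step keeps \<open>h \<le> 1 / 2\<close> for
    every \<open>n\<close>, as the slope lemma requires.\<close>
  have "2 \<le> sqrt (real n + 4)" by (rule real_le_rsqrt) simp
  then have h2: "h \<le> 1 / 2" unfolding h_def by (simp add: field_simps)
  have hh: "h\<^sup>2 * (N + 4) = 1" using N by (simp add: h_def N_def power_divide)
  then have hinv: "1 / h\<^sup>2 = N + 4" using h by (simp add: field_simps)
  obtain c where c: "\<bar>c\<bar> \<le> modulus1 f'' h / h"
    and le: "\<And>t. t \<in> {0..1} \<Longrightarrow> f'' t - f'' x \<le> c * (t - x) + (1 + (t - x)\<^sup>2 / (2 * h\<^sup>2)) * W"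
    using exists_slope[OF cont(3) h h2 x] unfolding W_def by blast
  define \<mu> where "\<mu> j = durr_op 0 n x (\<lambda>t. (t - x) ^ j)" for j
  define C where "C = (!) [f x, f' x, (f'' x + W) / 2, c / 6, W / (24 * h\<^sup>2)]"
  have "durr_op 0 n x f \<le> (\<Sum>i\<le>4. C i * \<mu> i)"
    unfolding \<mu>_def
  proof (rule durr_op_le_polynomial[OF cont(1) x])
    fix t :: real assume "t \<in> {0..1}"
    from taylor_le_quartic[OF C2 h x this le]
    show "f t \<le> (\<Sum>i\<le>4. C i * (t - x) ^ i)"
      unfolding sum_upto_small C_def by (simp add: add_divide_distrib distrib_right)
  qed
  also have "\<dots> = f x * \<mu> 0 + f' x * \<mu> 1 + (f'' x + W) / 2 * \<mu> 2 + c / 6 * \<mu> 3 + W / (24 * h\<^sup>2) * \<mu> 4"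
    unfolding sum_upto_small C_def by simp
  also have "\<mu> 0 = 1" unfolding \<mu>_def by (rule durr_op_central_moments)
  finally have "N * durr_op 0 n x f
      \<le> N * (f x * 1 + f' x * \<mu> 1 + (f'' x + W) / 2 * \<mu> 2 + c / 6 * \<mu> 3 + W / (24 * h\<^sup>2) * \<mu> 4)"
    using N by (intro mult_left_mono) auto
  also have "W / (24 * h\<^sup>2) = W / 24 * (N + 4)" unfolding hinv[symmetric] by simp
  \<comment> \<open>The limit terms are moved to the left and the error is grouped by
    \<open>f' x\<close>, \<open>f'' x\<close>, \<open>c\<close> and \<open>W\<close>.\<close>
  finally have main: "N * (durr_op 0 n x f - f x) - X * f'' x - (1 - 2 * x) * f' x
      \<le> f' x * (N * \<mu> 1 - (1 - 2 * x)) + f'' x * (N * \<mu> 2 / 2 - X) + c * (N * \<mu> 3 / 6)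
        + W * (N * \<mu> 2 / 2 + N * \<mu> 4 / 24 * (N + 4))"
    by (simp add: algebra_simps add_divide_distrib)
  note \<mu> = durr_op_central_moments(4-7)[of n x, folded \<mu>_def N_def]
  note bounds = durrmeyer_moment_bounds[OF N x, folded \<mu>, folded X_def]
  have 1: "f' x * (N * \<mu> 1 - (1 - 2 * x)) \<le> supnorm f' * (2 / (N + 2))"
  proof -
    have "\<bar>f' x * (N * \<mu> 1 - (1 - 2 * x))\<bar> \<le> supnorm f' * (2 / (N + 2))"
      unfolding abs_mult using abs_le_supnorm[OF cont(2) x] bounds(1) by (intro mult_mono) auto
    then show ?thesis by linarith
  qed
  have 2: "f'' x * (N * \<mu> 2 / 2 - X) \<le> supnorm f'' * (1 / (N + 2))"
  proof -
    have "\<bar>f'' x * (N * \<mu> 2 / 2 - X)\<bar> \<le> supnorm f'' * (1 / (N + 2))"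
      unfolding abs_mult using abs_le_supnorm[OF cont(3) x] bounds(2) by (intro mult_mono) auto
    then show ?thesis by linarith
  qed
  \<comment> \<open>The \<open>f''\<close> term consumes only one of the three multiples of
    \<open>supnorm f''\<close>; this accounts for the other two.\<close>
  have nonneg: "0 \<le> supnorm f'' * (2 / (N + 2))"
    using abs_le_supnorm[OF cont(3) x] N by simp
  have 3: "c * (N * \<mu> 3 / 6) \<le> 5 / sqrt (real n + 4) * modulus1 f'' h"
  proof -
    have "\<bar>N * \<mu> 3 / 6\<bar> \<le> 5 / (N + 4)" using bounds(3) N by (simp add: field_simps)
    also have "5 / (N + 4) = 5 * (1 / (N + 4))" by simp
    also have "1 / (N + 4) = h * h" using hh N by (simp add: field_simps power2_eq_square)
    finally have b: "\<bar>N * \<mu> 3 / 6\<bar> \<le> 5 * (h * h)" .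
    \<comment> \<open>The slope costs a factor \<open>1 / h\<close>, while the third moment supplies
      \<open>h * h\<close>, so one factor \<open>h\<close> survives.\<close>
    have "\<bar>c * (N * \<mu> 3 / 6)\<bar> \<le> modulus1 f'' h / h * (5 * (h * h))"
      unfolding abs_mult[of c] using c b by (intro mult_mono) auto
    also have "\<dots> = 5 * h * modulus1 f'' h" using h by simp
    also have "5 * h = 5 / sqrt (real n + 4)" by (simp add: h_def)
    finally show ?thesis by linarith
  qed
  have "0 \<le> W" unfolding W_def using cont h by (intro modulus2_nonneg) auto
  then have 4: "W * (N * \<mu> 2 / 2 + N * \<mu> 4 / 24 * (N + 4)) \<le> W * (9 / 8)"
    by (intro mult_left_mono bounds(4))
  have "1 / (N + 2) * (2 * supnorm f' + 3 * supnorm f'')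
      = supnorm f' * (2 / (N + 2)) + supnorm f'' * (1 / (N + 2)) + supnorm f'' * (2 / (N + 2))"
    by (simp add: add_divide_distrib[symmetric] mult.commute)
  then show ?thesis
    using main 1 2 nonneg 3 4 unfolding N_def[symmetric] X_def[symmetric] W_def[symmetric] by linarith
qed

lemma durrmeyer_voronovskaya:
  fixes n :: nat
  assumes C2: "C2_on_unit f f' f''" and x: "x \<in> {0..1}" and n: "1 \<le> n"
  shows "\<bar>real n * (durr_op 0 n x f - f x) - x * (1 - x) * f'' x - (1 - 2 * x) * f' x\<bar>
    \<le> 1 / (real n + 2) * (2 * supnorm f' + 3 * supnorm f'')
      + 5 / sqrt (real n + 4) * modulus1 f'' (1 / sqrt (real n + 4))
      + 9 / 8 * modulus2 f'' (1 / sqrt (real n + 4))"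
proof -
  have "supnorm (\<lambda>t. - g t) = supnorm g" for g by (simp add: supnorm_def)
  then show ?thesis
    using durrmeyer_voronovskaya_upper[OF C2 x n]
      durrmeyer_voronovskaya_upper[OF C2_on_unit_uminus[OF C2] x n]
    by (simp add: abs_le_iff durr_op_uminus modulus1_uminus modulus2_uminus algebra_simps)
qed

section \<open>The operator acting on the derivative\<close>

text \<open>\<open>M1\<close> and \<open>M2\<close> are the central moments for \<open>s = 1\<close>
  at order \<open>n - 1\<close>, hence \<open>N + 3\<close> and \<open>2 * N - 22\<close> in place
  of \<open>N + 4\<close> and \<open>2 * N - 20\<close>.\<close>

lemma durr_op_1_moment_bounds:
  fixes n :: nat and x h :: real
  assumes n: "1 \<le> n" and x: "x \<in> {0..1}"
  defines "N \<equiv> real n" and "\<delta> \<equiv> sqrt (2 / (real n + 2))"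
  defines "M1 \<equiv> (2 - 4 * x) / (N + 3)"
    and "M2 \<equiv> (6 + (2 * N - 22) * (x * (1 - x))) / ((N + 3) * (N + 4))"
  assumes h: "h = min \<delta> (1 / 2)"
  shows "N / (N + 2) * (\<bar>M1\<bar> / h) \<le> \<delta>"
    and "N / (N + 2) * (1 + M2 / (2 * h\<^sup>2)) \<le> 9 / 8"
proof -
  note X = logistic_bounds[OF x]
  have N: "1 \<le> N" using n by (simp add: N_def)
  have \<delta>: "0 < \<delta>" "\<delta>\<^sup>2 = 2 / (N + 2)" by (simp_all add: \<delta>_def N_def)
  have M1: "\<bar>M1\<bar> \<le> 2 / (N + 3)"
  proof -
    have "M1 = 2 * (1 - 2 * x) / (N + 3)" by (simp add: M1_def algebra_simps)
    then show ?thesis using X(3) N by (simp add: abs_mult divide_right_mono)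
  qed
  have "N / (N + 2) * (\<bar>M1\<bar> / h) \<le> \<delta> \<and> N / (N + 2) * (1 + M2 / (2 * h\<^sup>2)) \<le> 9 / 8"
  \<comment> \<open>The threshold is where \<open>\<delta>\<^sup>2 = 2 / (N + 2)\<close> drops to
    \<open>1 / 4\<close>, so that \<open>h = \<delta>\<close>.\<close>
  proof (cases "6 \<le> n")
    case True
    then have N6: "6 \<le> N" by (simp add: N_def)
    have "\<delta>\<^sup>2 \<le> (1 / 2)\<^sup>2" unfolding \<delta>(2) using N6 by (simp add: power2_eq_square divide_simps)
    then have "\<delta> \<le> 1 / 2" by (rule power2_le_imp_le) simp
    then have h: "h = \<delta>" using h by simp
    have "N / (N + 2) * (\<bar>M1\<bar> / h) \<le> 1 * (\<bar>M1\<bar> / h)"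
      using N h \<delta> by (intro mult_right_mono) auto
    also have "\<dots> \<le> 2 / (N + 2) / \<delta>"
    proof -
      have "2 / (N + 3) \<le> 2 / (N + 2)" using N by (intro divide_left_mono) auto
      then show ?thesis unfolding h mult_1_left using M1 \<delta> by (intro divide_right_mono) auto
    qed
    also have "\<dots> = \<delta>" using \<delta> by (metis less_irrefl nonzero_mult_div_cancel_left power2_eq_square)
    finally have 1: "N / (N + 2) * (\<bar>M1\<bar> / h) \<le> \<delta>" .
    have M2: "M2 / (2 * h\<^sup>2) = (6 + (2 * N - 22) * (x * (1 - x))) * (N + 2) / (4 * (N + 3) * (N + 4))"
      using N unfolding h \<delta>(2) M2_def by (simp add: divide_simps)
    have "N / (N + 2) * (1 + M2 / (2 * h\<^sup>2)) \<le> 9 / 8"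
    \<comment> \<open>At \<open>11\<close> the coefficient \<open>2 * N - 22\<close> changes sign;
      below, its term is dropped and the few remaining orders are checked numerically.\<close>
    proof (cases "11 \<le> n")
      case True
      then have N11: "11 \<le> N" by (simp add: N_def)
      have "(2 * N - 22) * (x * (1 - x)) \<le> (2 * N - 22) * (1 / 4)"
        using N11 X by (intro mult_left_mono) auto
      then have "6 + (2 * N - 22) * (x * (1 - x)) \<le> (N + 1) / 2" by simp
      then have "M2 / (2 * h\<^sup>2) \<le> (N + 1) / 2 * (N + 2) / (4 * (N + 3) * (N + 4))"
        unfolding M2 using N by (intro divide_right_mono mult_right_mono) auto
      also have "\<dots> \<le> 1 / 8" using N by (simp add: divide_simps) (simp add: algebra_simps)
      finally have "1 + M2 / (2 * h\<^sup>2) \<le> 9 / 8" by simp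
      then have "N / (N + 2) * (1 + M2 / (2 * h\<^sup>2)) \<le> N / (N + 2) * (9 / 8)"
        using N by (intro mult_left_mono) auto
      also have "\<dots> \<le> 1 * (9 / 8)" using N by (intro mult_right_mono) auto
      finally show ?thesis by simp
    next
      case False
      then have "N \<le> 10" by (simp add: N_def)
      then have "(2 * N - 22) * (x * (1 - x)) \<le> 0" using X by (intro mult_nonpos_nonneg) auto
      then have "M2 / (2 * h\<^sup>2) \<le> 6 * (N + 2) / (4 * (N + 3) * (N + 4))"
        unfolding M2 using N by (intro divide_right_mono mult_right_mono) auto
      then have "N / (N + 2) * (1 + M2 / (2 * h\<^sup>2))
          \<le> N / (N + 2) * (1 + 6 * (N + 2) / (4 * (N + 3) * (N + 4)))"
        using N by (intro mult_left_mono) auto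
      also have "n \<in> {6, 7, 8, 9, 10}" using True False by auto
      then have "N / (N + 2) * (1 + 6 * (N + 2) / (4 * (N + 3) * (N + 4))) \<le> 9 / 8"
        unfolding N_def by auto
      finally show ?thesis .
    qed
    with 1 show ?thesis by simp
  next
    case False
    then have N5: "N \<le> 5" by (simp add: N_def)
    have "(1 / 2)\<^sup>2 \<le> \<delta>\<^sup>2" unfolding \<delta>(2) using N N5 by (simp add: power2_eq_square divide_simps)
    then have \<delta>2: "1 / 2 \<le> \<delta>" by (rule power2_le_imp_le) (use \<delta> in simp)
    then have h: "h = 1 / 2" using h by simp
    have cases: "n \<in> {1, 2, 3, 4, 5}" using n False by auto
    have "N / (N + 2) * (\<bar>M1\<bar> / h) \<le> N / (N + 2) * (2 / (N + 3) / h)"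
      using N M1 h by (intro mult_left_mono divide_right_mono) auto
    \<comment> \<open>The factor \<open>N / (N + 2)\<close> matters here:
      \<open>2 / (N + 3) / h\<close> alone equals \<open>1\<close> for \<open>N = 1\<close>.\<close>
    also have "\<dots> \<le> 1 / 2" using cases unfolding N_def h by auto
    also note \<delta>2
    finally have 1: "N / (N + 2) * (\<bar>M1\<bar> / h) \<le> \<delta>" .
    have "(2 * N - 22) * (x * (1 - x)) \<le> 0" using X N5 by (intro mult_nonpos_nonneg) auto
    then have "M2 \<le> 6 / ((N + 3) * (N + 4))"
      unfolding M2_def using N by (intro divide_right_mono) auto
    then have "N / (N + 2) * (1 + M2 / (2 * h\<^sup>2)) \<le> N / (N + 2) * (1 + 6 / ((N + 3) * (N + 4)) / (2 * h\<^sup>2))"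
      using N by (intro mult_left_mono add_left_mono divide_right_mono) auto
    also have "\<dots> \<le> 9 / 8" using cases unfolding N_def h by (auto simp: power2_eq_square)
    finally show ?thesis using 1 by simp
  qed
  then show "N / (N + 2) * (\<bar>M1\<bar> / h) \<le> \<delta>"
    "N / (N + 2) * (1 + M2 / (2 * h\<^sup>2)) \<le> 9 / 8" by auto
qed

text \<open>For \<open>n < 6\<close> the step \<open>\<delta>\<close> exceeds \<open>1/2\<close>, where the slope lemma is not available; there
  it is used with step \<open>1/2\<close>.\<close>

lemma durr_op_1_upper:
  fixes g :: "real \<Rightarrow> real" and m :: nat
  assumes g: "continuous_on {0..1} g" and x: "x \<in> {0..1}"
  defines "n \<equiv> Suc m"
  defines "\<delta> \<equiv> sqrt (2 / (real n + 2))"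
  shows "real n / (real n + 2) * durr_op 1 m x g - g x
    \<le> 2 / (real n + 2) * \<bar>g x\<bar> + \<delta> * modulus1 g \<delta> + 9 / 8 * modulus2 g \<delta>"
proof -
  define N where "N = real n"
  define h where "h = min \<delta> (1 / 2)"
  have N: "1 \<le> N" by (simp add: N_def n_def)
  have \<delta>: "0 < \<delta>" by (simp add: \<delta>_def)
  have h: "0 < h" "h \<le> 1 / 2" "h \<le> \<delta>" using \<delta> by (auto simp: h_def)
  obtain c where c: "\<bar>c\<bar> \<le> modulus1 g h / h"
    and le: "\<And>t. t \<in> {0..1} \<Longrightarrow>
      g t - g x \<le> c * (t - x) + (1 + (t - x)\<^sup>2 / (2 * h\<^sup>2)) * modulus2 g h"
    using exists_slope[OF g h(1,2) x] by blast
  define W where "W = modulus2 g h"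
  define M where "M j = durr_op 1 m x (\<lambda>t. (t - x) ^ j)" for j
  define C where "C = (!) [g x + W, c, W / (2 * h\<^sup>2)]"
  have "durr_op 1 m x g \<le> (\<Sum>i\<le>2. C i * M i)"
    unfolding M_def
  proof (rule durr_op_le_polynomial[OF g x])
    fix t :: real assume "t \<in> {0..1}"
    from le[OF this] show "g t \<le> (\<Sum>i\<le>2. C i * (t - x) ^ i)"
      unfolding sum_upto_small C_def W_def by (simp add: algebra_simps)
  qed
  also have "\<dots> = (g x + W) * M 0 + c * M 1 + W / (2 * h\<^sup>2) * M 2"
    unfolding sum_upto_small C_def by simp
  also have "M 0 = 1" unfolding M_def by (rule durr_op_central_moments)
  finally have "durr_op 1 m x g \<le> g x + c * M 1 + (1 + M 2 / (2 * h\<^sup>2)) * W"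
    by (simp add: algebra_simps)
  then have "N / (N + 2) * durr_op 1 m x g \<le> N / (N + 2) * (g x + c * M 1 + (1 + M 2 / (2 * h\<^sup>2)) * W)"
    using N by (intro mult_left_mono) auto
  moreover have "q * (a + b + r * w) = q * a + q * b + q * r * w" for q a b r w :: real
    by (simp add: distrib_left)
  \<comment> \<open>The defect of \<open>N / (N + 2)\<close> from \<open>1\<close> is the source of
    the term with \<open>\<bar>g x\<bar>\<close> in the bound.\<close>
  moreover have "N / (N + 2) * g x = g x - 2 / (N + 2) * g x" using N by (simp add: field_simps)
  ultimately have main: "N / (N + 2) * durr_op 1 m x g - g x \<le> - (2 / (N + 2) * g x) + N / (N + 2) * (c * M 1)
      + (N / (N + 2) * (1 + M 2 / (2 * h\<^sup>2))) * W"
    by (simp only:)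
  have "M 1 = (2 - 4 * x) / (N + 3)" "M 2 = (6 + (2 * N - 22) * (x * (1 - x))) / ((N + 3) * (N + 4))"
    unfolding M_def durr_op_central_moments by (simp_all add: N_def n_def algebra_simps)
  note bounds = durr_op_1_moment_bounds[OF _ x h_def[unfolded \<delta>_def], folded \<delta>_def, folded N_def, folded this]
  have n: "1 \<le> n" by (simp add: n_def)
  have "\<bar>N / (N + 2) * (c * M 1)\<bar> = N / (N + 2) * (\<bar>c\<bar> * \<bar>M 1\<bar>)" using N by (simp add: abs_mult)
  also have "\<dots> \<le> N / (N + 2) * (modulus1 g h / h * \<bar>M 1\<bar>)"
    using N c by (intro mult_left_mono mult_right_mono) auto
  also have "\<dots> = N / (N + 2) * (\<bar>M 1\<bar> / h) * modulus1 g h" by simp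
  \<comment> \<open>The modulus at the possibly smaller step \<open>h\<close> is enlarged to the one
    at \<open>\<delta>\<close> by monotonicity.\<close>
  also have "\<dots> \<le> \<delta> * modulus1 g \<delta>"
    using \<delta> h by (intro mult_mono bounds n modulus1_mono g modulus1_nonneg) auto
  finally have 1: "N / (N + 2) * (c * M 1) \<le> \<delta> * modulus1 g \<delta>" by linarith
  have "0 \<le> W" unfolding W_def using g h by (intro modulus2_nonneg) auto
  then have "(N / (N + 2) * (1 + M 2 / (2 * h\<^sup>2))) * W \<le> 9 / 8 * W"
    by (intro mult_right_mono bounds n)
  also have "\<dots> \<le> 9 / 8 * modulus2 g \<delta>"
    unfolding W_def using g h by (intro mult_left_mono modulus2_mono) auto
  finally have 2: "(N / (N + 2) * (1 + M 2 / (2 * h\<^sup>2))) * W \<le> 9 / 8 * modulus2 g \<delta>" .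
  have "- (2 / (N + 2) * g x) \<le> \<bar>2 / (N + 2) * g x\<bar>" by linarith
  also have "\<dots> = 2 / (N + 2) * \<bar>g x\<bar>" using N by (simp add: abs_mult)
  finally show ?thesis using main 1 2 unfolding N_def[symmetric] by linarith
qed

lemma durr_op_1_estimate:
  fixes g :: "real \<Rightarrow> real" and m :: nat
  assumes g: "continuous_on {0..1} g" and x: "x \<in> {0..1}"
  defines "n \<equiv> Suc m"
  defines "\<delta> \<equiv> sqrt (2 / (real n + 2))"
  shows "\<bar>real n / (real n + 2) * durr_op 1 m x g - g x\<bar>
    \<le> 2 / (real n + 2) * \<bar>g x\<bar> + \<delta> * modulus1 g \<delta> + 9 / 8 * modulus2 g \<delta>"
  using durr_op_1_upper[OF g x, of m, folded n_def, folded \<delta>_def]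
    durr_op_1_upper[OF continuous_on_minus[OF g] x, of m, folded n_def, folded \<delta>_def]
  unfolding durr_op_uminus modulus1_uminus modulus2_uminus by (simp add: abs_le_iff)

section \<open>Decomposition of the modified operator and the final estimate\<close>

text \<open>Since \<open>2 a\<^sub>0 + a\<^sub>1 = 1\<close>, the modified basis differs from the classical one, which is
  the case \<open>a\<^sub>1 = -1\<close>, by a multiple of \<open>p\<^bsub>n-1,k-1\<^esub> - p\<^bsub>n-1,k\<^esub>\<close>; summation by parts and then
  integration by parts move this difference onto \<open>f\<close>.\<close>

lemma durrmeyer_M1_eq:
  assumes a: "2 * a0 (Suc m) + a1 (Suc m) = 1"
    and f: "\<And>t. t \<in> {0..1} \<Longrightarrow> (f has_real_derivative f' t) (at t within {0..1})"
    and f': "continuous_on {0..1} f'"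
  shows "durrmeyer_M1 a0 a1 (Suc m) f x
    = durr_op 0 (Suc m) x f + (1 + a1 (Suc m)) * (1 - 2 * x) / 2 * (durr_op 1 m x f' / (real m + 3))"
proof -
  define n where "n = Suc m"
  define I where "I k = integral {0..1} (\<lambda>t. Bernstein n k t * f t)" for k
  define p where "p = coef a0 a1 x n"
  define q where "q = coef a0 a1 (1 - x) n"
  \<comment> \<open>The condition on the coefficients makes \<open>p + q = 1\<close>, so both differ
    from the classical weights \<open>1 - x\<close> and \<open>x\<close> by the same amount with
    opposite signs.\<close>
  have pq: "p = 1 - x - (1 + a1 n) * (1 - 2 * x) / 2" "q = x + (1 + a1 n) * (1 - 2 * x) / 2"
    using a by (simp_all add: p_def q_def coef_def n_def field_simps)
  have "(\<Sum>k = 0..int n. bern_M1 a0 a1 n k x * integral {0..1} (\<lambda>t. bern n k t * f t))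
      = (\<Sum>k\<le>n. bern_M1 a0 a1 n (int k) x * integral {0..1} (\<lambda>t. bern n (int k) t * f t))"
    by (rule sum.reindex_bij_witness[of _ int nat]) auto
  also have "\<dots> = (\<Sum>k\<le>n. bern_M1 a0 a1 n (int k) x * I k)"
    by (intro sum.cong) (auto simp: bern_def I_def)
  also have "\<dots> = bern_M1 a0 a1 n 0 x * I 0 + (\<Sum>k\<le>m. bern_M1 a0 a1 n (int (Suc k)) x * I (Suc k))"
    unfolding n_def by (subst sum.atMost_Suc_shift) simp
  also have "bern_M1 a0 a1 n 0 x = p * Bernstein m 0 x"
    by (simp add: bern_M1_def bern_def n_def p_def)
  also have "(\<Sum>k\<le>m. bern_M1 a0 a1 n (int (Suc k)) x * I (Suc k))
      = (\<Sum>k\<le>m. (p * Bernstein m (Suc k) x + q * Bernstein m k x) * I (Suc k))"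
    by (intro sum.cong)
      (auto simp: bern_M1_def bern_def n_def p_def q_def Bernstein_eq_0 nat_add_distrib Suc_nat_eq_nat_zadd1)
  also have "\<dots> = (\<Sum>k\<le>m. p * Bernstein m (Suc k) x * I (Suc k)) + (\<Sum>k\<le>m. q * Bernstein m k x * I (Suc k))"
    by (simp add: distrib_right sum.distrib)
  \<comment> \<open>The split-off term for \<open>k = 0\<close> rejoins the first sum by an index
    shift; its new last term vanishes since \<open>Bernstein m (Suc m)\<close> is zero.\<close>
  also have "p * Bernstein m 0 x * I 0 + \<dots>
      = (\<Sum>k\<le>Suc m. p * Bernstein m k x * I k) + (\<Sum>k\<le>m. q * Bernstein m k x * I (Suc k))"
    by (subst sum.atMost_Suc_shift) simp
  also have "\<dots> = (\<Sum>k\<le>m. Bernstein m k x * (p * I k + q * I (Suc k)))"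
    by (simp add: Bernstein_eq_0 sum.distrib distrib_left mult_ac)
  also have "\<dots> = (\<Sum>k\<le>m. Bernstein m k x * ((1 - x) * I k + x * I (Suc k)))
      + (1 + a1 n) * (1 - 2 * x) / 2 * (\<Sum>k\<le>m. Bernstein m k x * (I (Suc k) - I k))"
    unfolding sum_distrib_left sum.distrib[symmetric]
    by (intro sum.cong refl) (simp add: pq algebra_simps add_divide_distrib diff_divide_distrib)
  also have "(\<Sum>k\<le>m. Bernstein m k x * ((1 - x) * I k + x * I (Suc k))) = (\<Sum>k\<le>n. Bernstein n k x * I k)"
    unfolding n_def by (rule sum_Bernstein_Suc[symmetric])
  finally have "durrmeyer_M1 a0 a1 n f x = (real n + 1) * (\<Sum>k\<le>n. Bernstein n k x * I k)
      + (1 + a1 n) * (1 - 2 * x) / 2 * ((real n + 1) * (\<Sum>k\<le>m. Bernstein m k x * (I (Suc k) - I k)))"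
    unfolding durrmeyer_M1_def by (simp add: distrib_left)
  also have "(real n + 1) * (\<Sum>k\<le>n. Bernstein n k x * I k) = durr_op 0 n x f"
    by (simp add: durr_op_def I_def)
  also have "(real n + 1) * (\<Sum>k\<le>m. Bernstein m k x * (I (Suc k) - I k))
      = (\<Sum>k\<le>m. Bernstein m k x * ((real n + 1) * (I (Suc k) - I k)))"
    by (simp add: sum_distrib_left mult.left_commute)
  also have "\<dots> = (\<Sum>k\<le>m. Bernstein m k x * integral {0..1} (\<lambda>t. Bernstein (Suc n) (Suc k) t * f' t))"
    unfolding I_def by (intro sum.cong refl arg_cong2[of _ _ _ _ "(*)"] integral_Bernstein_by_parts f f')
      (auto simp: n_def)
  \<comment> \<open>\<open>real m + 3\<close> is the normalising factor of
    \<open>durr_op 1 m\<close>, and equals \<open>n + 2\<close>.\<close>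
  also have "\<dots> = durr_op 1 m x f' / (real m + 3)"
    by (simp add: durr_op_def n_def add_ac)
  finally show ?thesis unfolding n_def .
qed

theorem theorem7p3:
  fixes a0 a1 :: "nat \<Rightarrow> real" and L1 :: real and f f' f'' :: "real \<Rightarrow> real"
    and n :: nat and x :: real
  assumes "\<And>m. m \<ge> 1 \<Longrightarrow> 2 * a0 m + a1 m = 1"
    and "C2_on_unit f f' f''"
    and "a1 \<longlonglongrightarrow> L1"
    and "x \<in> {0..1}"
    and "n \<ge> 1"
  shows "\<bar>real n * (durrmeyer_M1 a0 a1 n f x - f x)
            - x * (1 - x) * f'' x - (1 - 2 * x) / 2 * (L1 + 3) * f' x\<bar>
    \<le> 1 / (real n + 2) * (2 * supnorm f' + 3 * supnorm f'')
      + 5 / sqrt (real n + 4) * modulus1 f'' (1 / sqrt (real n + 4))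
      + 9 / 8 * modulus2 f'' (1 / sqrt (real n + 4))
      + 1 / 2 * (\<bar>L1 - a1 n\<bar> * supnorm f'
          + \<bar>1 + L1\<bar> * (2 / (real n + 2) * \<bar>f' x\<bar>
              + sqrt (2 / (real n + 2)) * modulus1 f' (sqrt (2 / (real n + 2)))
              + 9 / 8 * modulus2 f' (sqrt (2 / (real n + 2)))))"
proof -
  note C2 = assms(2) and x = assms(4)
  note cont = C2_on_unit_continuous[OF C2]
  obtain m where n: "n = Suc m" using assms(5) by (cases n) auto
  define V where "V = real n / (real n + 2) * durr_op 1 m x f'"
  define E where "E = real n * (durr_op 0 n x f - f x) - x * (1 - x) * f'' x - (1 - 2 * x) * f' x"
  define R where "R = 2 / (real n + 2) * \<bar>f' x\<bar>
              + sqrt (2 / (real n + 2)) * modulus1 f' (sqrt (2 / (real n + 2)))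
              + 9 / 8 * modulus2 f' (sqrt (2 / (real n + 2)))"
  have R: "\<bar>V - f' x\<bar> \<le> R"
    unfolding V_def R_def n by (rule durr_op_1_estimate[OF cont(2) x])
  have V: "\<bar>V\<bar> \<le> supnorm f'"
  proof -
    have "\<bar>V\<bar> = real n / (real n + 2) * \<bar>durr_op 1 m x f'\<bar>" by (simp add: V_def abs_mult)
    also have "\<dots> \<le> 1 * supnorm f'"
      by (intro mult_mono abs_durr_le_supnorm cont x) auto
    finally show ?thesis by simp
  qed
  have "durrmeyer_M1 a0 a1 n f x = durr_op 0 n x f + (1 + a1 n) * (1 - 2 * x) / 2 * (durr_op 1 m x f' / (real m + 3))"
    unfolding n using assms(1)[of "Suc m"] C2 cont
    by (intro durrmeyer_M1_eq) (auto simp: C2_on_unit_def)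
  then have "real n * durrmeyer_M1 a0 a1 n f x = real n * durr_op 0 n x f + (1 + a1 n) * (1 - 2 * x) / 2 * V"
    by (simp add: V_def n distrib_left add.commute mult_ac)
  \<comment> \<open>Write \<open>(L1 + 3) / 2 = 1 + (1 + L1) / 2\<close>: the \<open>1\<close>
    belongs to the classical operator, and the rest is compared with
    \<open>(1 + a1 n) / 2 * V\<close> after adding and subtracting
    \<open>(1 + L1) * V\<close>.\<close>
  then have "real n * (durrmeyer_M1 a0 a1 n f x - f x)
            - x * (1 - x) * f'' x - (1 - 2 * x) / 2 * (L1 + 3) * f' x
      = E + (1 - 2 * x) / 2 * ((a1 n - L1) * V + (1 + L1) * (V - f' x))"
    unfolding E_def by (simp add: field_simps)
  also have "\<bar>\<dots>\<bar> \<le> \<bar>E\<bar> + \<bar>(1 - 2 * x) / 2 * ((a1 n - L1) * V + (1 + L1) * (V - f' x))\<bar>"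
    by (rule abs_triangle_ineq)
  also have "\<bar>(1 - 2 * x) / 2 * ((a1 n - L1) * V + (1 + L1) * (V - f' x))\<bar>
      \<le> 1 / 2 * (\<bar>L1 - a1 n\<bar> * supnorm f' + \<bar>1 + L1\<bar> * R)"
  proof -
    have "\<bar>(a1 n - L1) * V + (1 + L1) * (V - f' x)\<bar> \<le> \<bar>a1 n - L1\<bar> * \<bar>V\<bar> + \<bar>1 + L1\<bar> * \<bar>V - f' x\<bar>"
      unfolding abs_mult[symmetric] by (rule abs_triangle_ineq)
    also have "\<dots> \<le> \<bar>L1 - a1 n\<bar> * supnorm f' + \<bar>1 + L1\<bar> * R"
      unfolding abs_minus_commute[of "a1 n" L1] by (intro add_mono mult_left_mono V R) auto
    finally show ?thesis
      unfolding abs_mult using logistic_bounds(3)[OF x] by (intro mult_mono) auto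
  qed
  finally show ?thesis
    using durrmeyer_voronovskaya[OF C2 x assms(5)] unfolding E_def[symmetric] R_def by linarith
qed

end
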